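(* The lens space $L(4,1)=SU(2)/\!\approx$ is diffeomorphic to $PTS^2$, the bundle of (unoriented) directions of the sphere $S^2$, via the map which in coordinates reads $[a,b,c]\mapsto(a,b,-c)$ (i.e. the coordinates $(a,b,c)$ on $L(4,1)$ correspond to the coordinates $(a,b,\xi)=(a,b,-c)$ on $PTS^2$). This diffeomorphism maps horizontal curves of $L(4,1)$ to horizontal curves of $PTS^2$ and vice versa, and the sub-Riemannian length of a horizontal curve $(a(\cdot),b(\cdot),c(\cdot))$ in $L(4,1)$ equals the cost $\mathcal{J}[\Gamma]$ (with $\beta=1$) of the curve $\Gamma(\cdot)=(a(\cdot),b(\cdot),-c(\cdot))$ in $PTS^2$.
   Context: $SU(2)$, $p_1=\frac12\begin{pmatrix}0&1\\-1&0\end{pmatrix}$, $p_2=\frac12\begin{pmatrix}0&i\\i&0\end{pmatrix}$; the sub-Riemannian structure on $SU(2)$ has distribution $\Delta(g)=g\,\mathrm{span}\{p_1,p_2\}$ and metric making $gp_1,gp_2$ orthonormal. Coordinates $(a,b,c)$ on $SU(2)$: $g=e^{-bp_2}e^{ap_1}e^{cp_2}$, $a\in[0,\pi]$, $b\in[0,2\pi)$, $c\in\mathbb{R}/4\pi$. $g_1\approx g_2$ iff they admit such coordinates with equal $a$, equal $b$, and $c$ equal modulo $\pi$; $L(4,1)=SU(2)/\!\approx$ carries the sub-Riemannian structure induced through the quotient map $\Pi$ (distribution $\Pi_*\Delta$, metric pushed forward, well defined), with length of horizontal curves $\int\sqrt{\mathbf{g}(\dot\gamma,\dot\gamma)}dt$.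 $PTS^2$: on $S^2\subset\mathbb{R}^3$ use spherical coordinates $(y_1,y_2,y_3)=(\sin a\cos b,\sin a\sin b,\cos a)$ with the standard round metric $da^2+\sin^2(a)\,db^2$; a point of $PTS^2$ is $(a,b,\xi)$ with $\xi\in\mathbb{R}/\pi$ the angle between the direction and $\partial_a$. A curve $\Gamma=(\gamma,\xi)$ is horizontal if it is the lift of a curve $\gamma$ on $S^2$ ($\xi(t)$ the direction of $\dot\gamma(t)$); equivalently $\dot\Gamma=u_1F_1+u_2F_2$ with $F_1=(\cos\xi,\ \sin\xi/\sin a,\ -\cot(a)\sin\xi)$, $F_2=(0,0,1)$ in coordinates $(a,b,\xi)$. The cost is $\mathcal{J}[\Gamma]=\int_0^T\sqrt{\mathbf{g}(\dot\gamma,\dot\gamma)+\beta^2K_\gamma^2\,\mathbf{g}(\dot\gamma,\dot\gamma)}\,dt=\int_0^T\sqrt{u_1^2+\beta^2u_2^2}\,dt$, where $K_\gamma$ is the geodesic curvature of $\gamma$ and $\beta\neq0$ is a constant. *)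

theory Defs
  imports "HOL-Analysis.Analysis"
begin

unbundle no cross3_syntax

fun Ck_on :: "nat \<Rightarrow> 'a::real_normed_vector set \<Rightarrow> ('a \<Rightarrow> 'b::real_normed_vector) \<Rightarrow> bool" where
  "Ck_on 0 U f = continuous_on U f"
| "Ck_on (Suc n) U f =
     (\<exists>f'. (\<forall>x\<in>U. (f has_derivative f' x) (at x)) \<and> (\<forall>v. Ck_on n U (\<lambda>x. f' x v)))"

definition smooth_on :: "'a::real_normed_vector set \<Rightarrow> ('a \<Rightarrow> 'b::real_normed_vector) \<Rightarrow> bool" where
  "smooth_on U f \<longleftrightarrow> open U \<and> (\<forall>n. Ck_on n U f)"

type_synonym cmat = "complex^2^2"

definition adjoint_mat :: "cmat \<Rightarrow> cmat" where
  "adjoint_mat g = (\<chi> i j. cnj (g $ j $ i))"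

definition SU2 :: "cmat set" where
  "SU2 = {g. g ** adjoint_mat g = mat 1 \<and> det g = 1}"

definition mat2 :: "complex \<Rightarrow> complex \<Rightarrow> complex \<Rightarrow> complex \<Rightarrow> cmat" where
  "mat2 x11 x12 x21 x22 = vector [vector [x11, x12], vector [x21, x22]]"

definition p1 :: cmat where "p1 = mat2 0 (1/2) (-1/2) 0"
definition p2 :: cmat where "p2 = mat2 0 (\<i>/2) (\<i>/2) 0"

definition matpow :: "cmat \<Rightarrow> nat \<Rightarrow> cmat" where
  "matpow M n = ((\<lambda>X. M ** X) ^^ n) (mat 1)"

definition mexp :: "cmat \<Rightarrow> cmat" where
  "mexp M = (\<Sum>n. (1 / fact n) *\<^sub>R matpow M n)"

text \<open>Coordinates (a,b,c): g = exp(-b p2) exp(a p1) exp(c p2), a in [0,pi], b in [0,2pi),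
  c real (taken modulo 4 pi).\<close>
definition coords :: "cmat \<Rightarrow> real \<Rightarrow> real \<Rightarrow> real \<Rightarrow> bool" where
  "coords g a b c \<longleftrightarrow> 0 \<le> a \<and> a \<le> pi \<and> 0 \<le> b \<and> b < 2 * pi \<and>
     g = mexp ((- b) *\<^sub>R p2) ** mexp (a *\<^sub>R p1) ** mexp (c *\<^sub>R p2)"

definition approx :: "cmat \<Rightarrow> cmat \<Rightarrow> bool" where
  "approx g1 g2 \<longleftrightarrow> (\<exists>a b c1 c2 k. coords g1 a b c1 \<and> coords g2 a b c2 \<and> c1 - c2 = of_int k * pi)"

definition PiL :: "cmat \<Rightarrow> cmat set" where
  "PiL g = {h \<in> SU2. approx g h}"

definition L41 :: "cmat set set" where
  "L41 = PiL ` SU2"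

definition hor_SU2_ctrl :: "real \<Rightarrow> (real \<Rightarrow> cmat) \<Rightarrow> (real \<Rightarrow> real) \<Rightarrow> (real \<Rightarrow> real) \<Rightarrow> bool" where
  "hor_SU2_ctrl T g u1 u2 \<longleftrightarrow>
     (\<forall>t\<in>{0..T}. g t \<in> SU2) \<and>
     u1 absolutely_integrable_on {0..T} \<and> u2 absolutely_integrable_on {0..T} \<and>
     (\<forall>t\<in>{0..T}. ((\<lambda>s. g s ** (u1 s *\<^sub>R p1 + u2 s *\<^sub>R p2))
                     has_integral (g t - g 0)) {0..t})"

definition hor_SU2 :: "real \<Rightarrow> (real \<Rightarrow> cmat) \<Rightarrow> bool" where
  "hor_SU2 T g \<longleftrightarrow> (\<exists>u1 u2. hor_SU2_ctrl T g u1 u2)"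

definition length_SU2 :: "real \<Rightarrow> (real \<Rightarrow> cmat) \<Rightarrow> real" where
  "length_SU2 T g = (SOME l. \<exists>u1 u2. hor_SU2_ctrl T g u1 u2 \<and>
       l = integral {0..T} (\<lambda>s. sqrt ((u1 s)\<^sup>2 + (u2 s)\<^sup>2)))"

text \<open>Horizontal curves of L(4,1): images under PiL of horizontal curves of SU(2)
  (PiL is a covering, so every curve of L(4,1) lifts).\<close>
definition hor_L41 :: "real \<Rightarrow> (real \<Rightarrow> cmat set) \<Rightarrow> bool" where
  "hor_L41 T \<gamma> \<longleftrightarrow> (\<exists>g. hor_SU2 T g \<and> (\<forall>t\<in>{0..T}. \<gamma> t = PiL (g t)))"

definition length_L41 :: "real \<Rightarrow> (real \<Rightarrow> cmat set) \<Rightarrow> real" where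
  "length_L41 T \<gamma> = (SOME l. \<exists>g. hor_SU2 T g \<and> (\<forall>t\<in>{0..T}. \<gamma> t = PiL (g t)) \<and>
       l = length_SU2 T g)"

type_synonym pts = "(real^3) \<times> (real^3^3)"

definition outer :: "real^3 \<Rightarrow> real^3^3" where
  "outer v = (\<chi> i j. v $ i * v $ j)"

definition PTS2 :: "pts set" where
  "PTS2 = {(y, outer v) | y v. norm y = 1 \<and> norm v = 1 \<and> y \<bullet> v = 0}"

definition sph :: "real \<Rightarrow> real \<Rightarrow> real^3" where
  "sph a b = vector [sin a * cos b, sin a * sin b, cos a]"
definition e_a :: "real \<Rightarrow> real \<Rightarrow> real^3" where
  "e_a a b = vector [cos a * cos b, cos a * sin b, - sin a]"
definition e_b :: "real \<Rightarrow> real \<Rightarrow> real^3" where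
  "e_b a b = vector [- sin b, cos b, 0]"

text \<open>The point of PT S^2 with coordinates (a,b,xi): xi is the angle from d/da.\<close>
definition pts_pt :: "real \<Rightarrow> real \<Rightarrow> real \<Rightarrow> pts" where
  "pts_pt a b xi = (sph a b, outer (cos xi *\<^sub>R e_a a b + sin xi *\<^sub>R e_b a b))"

text \<open>Horizontal curves of PT S^2 (coordinate-free form of dGamma = u1 F1 + u2 F2), with a
  continuous unit lift v of the direction: y' = u1 v, v' = - u1 y + u2 (y x v).\<close>
definition hor_PTS_ctrl :: "real \<Rightarrow> (real \<Rightarrow> pts) \<Rightarrow> (real \<Rightarrow> real) \<Rightarrow> (real \<Rightarrow> real) \<Rightarrow> bool" where
  "hor_PTS_ctrl T \<Gamma> u1 u2 \<longleftrightarrow>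
     (\<forall>t\<in>{0..T}. \<Gamma> t \<in> PTS2) \<and>
     u1 absolutely_integrable_on {0..T} \<and> u2 absolutely_integrable_on {0..T} \<and>
     (\<exists>y v. (\<forall>t\<in>{0..T}. \<Gamma> t = (y t, outer (v t)) \<and> norm (v t) = 1 \<and> y t \<bullet> v t = 0) \<and>
        (\<forall>t\<in>{0..T}. ((\<lambda>s. u1 s *\<^sub>R v s) has_integral (y t - y 0)) {0..t}) \<and>
        (\<forall>t\<in>{0..T}. ((\<lambda>s. u2 s *\<^sub>R cross3 (y s) (v s) - u1 s *\<^sub>R y s)
                         has_integral (v t - v 0)) {0..t}))"

definition hor_PTS :: "real \<Rightarrow> (real \<Rightarrow> pts) \<Rightarrow> bool" where
  "hor_PTS T \<Gamma> \<longleftrightarrow> (\<exists>u1 u2. hor_PTS_ctrl T \<Gamma> u1 u2)"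

definition cost_PTS :: "real \<Rightarrow> real \<Rightarrow> (real \<Rightarrow> pts) \<Rightarrow> real" where
  "cost_PTS \<beta> T \<Gamma> = (SOME c. \<exists>u1 u2. hor_PTS_ctrl T \<Gamma> u1 u2 \<and>
       c = integral {0..T} (\<lambda>s. sqrt ((u1 s)\<^sup>2 + \<beta>\<^sup>2 * (u2 s)\<^sup>2)))"

definition PhiL :: "cmat set \<Rightarrow> pts" where
  "PhiL X = (SOME p. \<exists>g\<in>X. \<exists>a b c. coords g a b c \<and> p = pts_pt a b (- c))"

end

theory Submission
  imports Defs
begin

text \<open>The adjoint action turns \<open>g\<close> in SU(2) into an orthonormal frame \<open>(base g, dir g, base g \<times> dir g)\<close>
  of three-space whose entries are quadratic in the entries of \<open>g\<close>. In the coordinates \<open>(a, b, c)\<close> the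
  first two vectors are the point of the sphere and the unit tangent vector at angle \<open>- c\<close>, so
  \<open>g \<mapsto> (base g, outer (dir g))\<close> is a smooth map onto \<open>PTS2\<close> whose fibres are exactly the classes of
  \<open>approx\<close>. Differentiating, a curve \<open>g' = g (u1 p1 + u2 p2)\<close> yields a frame that solves the
  horizontality equations with controls \<open>(u1, - u2)\<close>; conversely a horizontal curve is lifted by solving
  this linear equation in SU(2) and comparing frames. As controls are only integrable, all
  differential equations are integral equations, and the calculus needed is a product rule for
  indefinite integrals.\<close>

section \<open>Indefinite integrals of absolutely integrable functions\<close>

text \<open>\<open>PhiL\<close>, \<open>length_SU2\<close>, \<open>length_L41\<close> and
  \<open>cost_PTS\<close> select a value with \<open>SOME\<close>, so each needs a proof that
  representatives, coordinates, lifts and controls do not matter. Coordinates degenerate at the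
  poles \<open>a = 0\<close> and \<open>a = pi\<close>, where \<open>b\<close> is arbitrary; the
  frame is a function of \<open>g\<close> alone and has no such singularity. A point of
  \<open>PTS2\<close> keeps its direction only up to sign, so the vector along a curve is also
  ambiguous by a sign, which continuity makes global. Smoothness of the quotient map is expressed
  upstairs: forwards on a neighbourhood of SU(2), backwards by local sections. These sections cannot
  be merged into one, because a four-sheeted covering with connected total space has no global
  continuous section. The sign in \<open>- c\<close> arises because a growing \<open>c\<close> turns
  \<open>dir g\<close> from \<open>e_a\<close> towards \<open>- e_b\<close>. For curves it becomes
  the change from \<open>u2\<close> to \<open>- u2\<close>, which the squares in length and cost do
  not see.\<close>

definition primitive_on :: "real \<Rightarrow> (real \<Rightarrow> 'a::euclidean_space) \<Rightarrow> (real \<Rightarrow> 'a) \<Rightarrow> bool" where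
  "primitive_on T f f' \<longleftrightarrow> f' absolutely_integrable_on {0..T} \<and>
     (\<forall>t\<in>{0..T}. (f' has_integral (f t - f 0)) {0..t})"

lemma primitive_on_interval:
  assumes "primitive_on T f f'" "0 \<le> s" "s \<le> t" "t \<le> T"
  shows "(f' has_integral (f t - f s)) {s..t}"
proof -
  have t: "(f' has_integral (f t - f 0)) {0..t}" and s: "(f' has_integral (f s - f 0)) {0..s}"
    using assms by (auto simp: primitive_on_def)
  have i: "f' integrable_on {0..t}" using t by blast
  have "f' integrable_on {s..t}"
    by (rule integrable_subinterval_real[OF i]) (use assms in auto)
  moreover have "integral {0..s} f' + integral {s..t} f' = integral {0..t} f'"
    by (rule Henstock_Kurzweil_Integration.integral_combine) (use assms i in auto)
  moreover have "integral {0..s} f' = f s - f 0" "integral {0..t} f' = f t - f 0"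
    using t s by (auto dest: integral_unique)
  ultimately show ?thesis
    by (metis add_diff_cancel_left' diff_add_cancel diff_diff_eq2 has_integral_integral)
qed

text \<open>Requires no absolute integrability of \<open>f'\<close>, so continuity of a solution is
  available before the right-hand side of its equation is known to be absolutely integrable.\<close>

lemma has_integral_imp_continuous_on:
  fixes f :: "real \<Rightarrow> 'a::euclidean_space"
  assumes "\<And>t. t \<in> {0..T} \<Longrightarrow> (f' has_integral (f t - f 0)) {0..t}"
  shows "continuous_on {0..T} f"
proof (cases "0 \<le> T")
  case True
  then have "f' integrable_on {0..T}"
    using assms[of T] by auto
  then have "continuous_on {0..T} (\<lambda>t. f 0 + integral {0..t} f')"
    by (intro continuous_intros indefinite_integral_continuous_1)
  moreover have "f 0 + integral {0..t} f' = f t" if "t \<in> {0..T}" for t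
    using integral_unique[OF assms[OF that]] by simp
  ultimately show ?thesis by (rule continuous_on_eq)
qed simp

lemma primitive_on_continuous: "primitive_on T f f' \<Longrightarrow> continuous_on {0..T} f"
  by (rule has_integral_imp_continuous_on[of T f']) (simp add: primitive_on_def)

lemma primitive_on_const: "primitive_on T (\<lambda>_. c) (\<lambda>_. 0)"
  by (simp add: primitive_on_def)

lemma primitive_on_integral:
  assumes "f absolutely_integrable_on {0..T}"
  shows "primitive_on T (\<lambda>t. c + integral {0..t} f) f"
  unfolding primitive_on_def
proof (intro conjI ballI)
  fix t assume "t \<in> {0..T}"
  moreover have "f integrable_on {0..T}"
    using assms by (simp add: absolutely_integrable_on_def)
  ultimately have "f integrable_on {0..t}"
    by (auto intro: integrable_subinterval_real)
  then show "(f has_integral c + integral {0..t} f - (c + integral {0..0} f)) {0..t}"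
    by (simp add: has_integral_iff)
qed fact

lemma primitive_on_add:
  assumes "primitive_on T f f'" "primitive_on T g g'"
  shows "primitive_on T (\<lambda>t. f t + g t) (\<lambda>t. f' t + g' t)"
  using assms unfolding primitive_on_def
  by (auto simp: add_diff_add intro!: has_integral_add set_integral_add)

lemma primitive_on_linear:
  assumes "bounded_linear L" "primitive_on T f f'"
  shows "primitive_on T (\<lambda>t. L (f t)) (\<lambda>t. L (f' t))"
proof -
  interpret bounded_linear L by fact
  show ?thesis
    using assms absolutely_integrable_linear[of "{0..T}" f' L]
      has_integral_linear[of f' _ _ L]
    unfolding primitive_on_def by (auto simp: o_def diff[symmetric])
qed

lemma primitive_on_sum:
  assumes "\<And>i. i \<in> I \<Longrightarrow> primitive_on T (f i) (f' i)"
  shows "primitive_on T (\<lambda>t. \<Sum>i\<in>I. f i t) (\<lambda>t. \<Sum>i\<in>I. f' i t)"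
  using assms
  by (induction I rule: infinite_finite_induct) (auto intro: primitive_on_add primitive_on_const)

lemma primitive_on_cong:
  assumes "primitive_on T f f'" "\<And>t. t \<in> {0..T} \<Longrightarrow> f t = g t" "\<And>t. t \<in> {0..T} \<Longrightarrow> f' t = g' t"
  shows "primitive_on T g g'"
  unfolding primitive_on_def
proof (intro conjI ballI)
  show "g' absolutely_integrable_on {0..T}"
    using assms(1) set_integrable_cong[of lebesgue lebesgue "{0..T}" "{0..T}" f' g', OF refl refl assms(3)]
    by (simp add: primitive_on_def)
  fix t assume t: "t \<in> {0..T}"
  show "(g' has_integral g t - g 0) {0..t}"
    by (rule has_integral_eq[of _ f'])
      (use t assms in \<open>auto simp: primitive_on_def\<close>)
qed

lemma primitive_on_diff:
  assumes "primitive_on T f f'" "primitive_on T g g'"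
  shows "primitive_on T (\<lambda>t. f t - g t) (\<lambda>t. f' t - g' t)"
proof -
  have "primitive_on T (\<lambda>t. - g t) (\<lambda>t. - g' t)"
    using primitive_on_linear[OF bounded_linear_minus[OF bounded_linear_ident] assms(2)] .
  from primitive_on_add[OF assms(1) this] show ?thesis by simp
qed

lemma primitive_on_componentwise:
  fixes f :: "real \<Rightarrow> 'a::euclidean_space"
  assumes "\<And>b. b \<in> Basis \<Longrightarrow> primitive_on T (\<lambda>t. f t \<bullet> b) (\<lambda>t. f' t \<bullet> b)"
  shows "primitive_on T f f'"
proof -
  have "primitive_on T (\<lambda>t. \<Sum>b\<in>Basis. (f t \<bullet> b) *\<^sub>R b) (\<lambda>t. \<Sum>b\<in>Basis. (f' t \<bullet> b) *\<^sub>R b)"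
    by (intro primitive_on_sum primitive_on_linear[OF bounded_linear_scaleR_left] assms)
  then show ?thesis by (simp add: euclidean_representation)
qed

lemma primitive_on_zero:
  assumes "primitive_on T f (\<lambda>_. 0)" "t \<in> {0..T}"
  shows "f t = f 0"
proof -
  have "((\<lambda>_. 0) has_integral f t - f 0) {0..t}"
    using assms unfolding primitive_on_def by blast
  from has_integral_unique[OF this has_integral_0] show ?thesis by simp
qed

section \<open>Product rule for indefinite integrals\<close>

text \<open>A local bound on increments becomes global by cutting \<open>{0..t}\<close> into
  \<open>n\<close> equal pieces shorter than \<open>d\<close>; the right-hand sides
  telescope.\<close>

lemma increment_bound:
  fixes D :: "real \<Rightarrow> 'a::real_normed_vector"
  assumes "0 \<le> t" "0 < d"
    and le: "\<And>r s. 0 \<le> r \<Longrightarrow> r \<le> s \<Longrightarrow> s \<le> t \<Longrightarrow> s - r < d \<Longrightarrow> norm (D s - D r) \<le> K s - K r"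
  shows "norm (D t - D 0) \<le> K t - K 0"
proof -
  obtain n :: nat where n: "t / d < real n"
    using reals_Archimedean2 by blast
  with assms have n0: "0 < n"
    by (metis divide_nonneg_pos of_nat_0_less_iff order_le_less_trans)
  have "norm (D (t * i / n) - D 0) \<le> K (t * i / n) - K 0" if "i \<le> n" for i :: nat
    using that
  proof (induction i)
    case (Suc i)
    have "t * real (Suc i) / n \<le> t"
      using Suc.prems n0 assms(1) by (simp add: divide_le_eq mult_left_mono del: of_nat_Suc)
    moreover have "t * real (Suc i) / n - t * i / n < d"
      using n n0 assms by (simp add: field_simps)
    moreover have "t * i / n \<le> t * real (Suc i) / n"
      using n0 assms by (intro divide_right_mono mult_left_mono) auto
    ultimately have "norm (D (t * real (Suc i) / n) - D (t * i / n)) \<le> K (t * real (Suc i) / n) - K (t * i / n)"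
      using assms by (intro le) auto
    with Suc show ?case
      using norm_triangle_ineq[of "D (t * real (Suc i) / n) - D (t * i / n)" "D (t * i / n) - D 0"]
      by (simp del: of_nat_Suc)
  qed simp
  from this[of n] n0 show ?thesis by simp
qed

text \<open>On a compact interval the continuous factor is bounded and measurable. This makes the
  right-hand sides of the control equations integrable.\<close>

lemma absolutely_integrable_bilinear:
  fixes f :: "real \<Rightarrow> 'a::euclidean_space" and g :: "real \<Rightarrow> 'b::euclidean_space"
    and h :: "'a \<Rightarrow> 'b \<Rightarrow> 'c::euclidean_space"
  assumes h: "bounded_bilinear h"
    and f: "continuous_on {0..T} f" and g: "g absolutely_integrable_on {0..T}"
  shows "(\<lambda>t. h (f t) (g t)) absolutely_integrable_on {0..T}"
proof (rule absolutely_integrable_bounded_measurable_product[where h = h])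
  show "bilinear h" using h by (simp add: bilinear_conv_bounded_bilinear)
  show "f \<in> borel_measurable (lebesgue_on {0..T})"
    by (rule continuous_imp_measurable_on_sets_lebesgue[OF f]) simp
  show "bounded (f ` {0..T})"
    by (intro compact_imp_bounded compact_continuous_image f) simp
qed (use g in auto)

text \<open>The defect \<open>D\<close> between the product and the integral of the expected density
  \<open>P\<close> has increments over short intervals of at most \<open>e\<close> times those of
  \<open>K\<close>, the integral of \<open>norm f' + norm g'\<close>. This follows from uniform
  continuity of \<open>f\<close> and \<open>g\<close>. Hence \<open>D\<close> is constant.\<close>

lemma primitive_on_bilinear:
  fixes f :: "real \<Rightarrow> 'a::euclidean_space" and g :: "real \<Rightarrow> 'b::euclidean_space"
    and h :: "'a \<Rightarrow> 'b \<Rightarrow> 'c::euclidean_space"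
  assumes h: "bounded_bilinear h" and f: "primitive_on T f f'" and g: "primitive_on T g g'"
  shows "primitive_on T (\<lambda>t. h (f t) (g t)) (\<lambda>t. h (f' t) (g t) + h (f t) (g' t))"
proof -
  interpret bounded_bilinear h by fact
  note cont = primitive_on_continuous[OF f] primitive_on_continuous[OF g]
  have ai: "f' absolutely_integrable_on {0..T}" "g' absolutely_integrable_on {0..T}"
    using f g by (auto simp: primitive_on_def)
  define P where "P = (\<lambda>t. h (f' t) (g t) + h (f t) (g' t))"
  define k where "k = (\<lambda>t. norm (f' t) + norm (g' t))"
  have P: "P absolutely_integrable_on {0..T}"
    unfolding P_def using ai cont
    by (intro set_integral_add absolutely_integrable_bilinear[OF h]
        absolutely_integrable_bilinear[OF flip]) 
  have k: "k absolutely_integrable_on {0..T}"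
    unfolding k_def using ai by (intro set_integral_add(1)) (auto dest: absolutely_integrable_norm simp: o_def)
  define D where "D t = h (f t) (g t) - integral {0..t} P" for t
  define K where "K t = 0 + integral {0..t} k" for t
  have pP: "primitive_on T (\<lambda>t. 0 + integral {0..t} P) P" and pk: "primitive_on T K k"
    unfolding K_def by (intro primitive_on_integral P k)+
  obtain B where B: "B > 0" "\<And>a b. norm (h a b) \<le> norm a * norm b * B"
    using pos_bounded by blast
  have D: "D t = D 0" if t: "t \<in> {0..T}" for t
  proof -
    have "norm (D t - D 0) \<le> e * (K t - K 0)" if e: "e > 0" for e
    proof -
      have uc: "uniformly_continuous_on {0..T} f" "uniformly_continuous_on {0..T} g"
        by (auto intro!: compact_uniformly_continuous cont)
      obtain d1 where d1: "d1 > 0" "\<And>r s. r \<in> {0..T} \<Longrightarrow> s \<in> {0..T} \<Longrightarrow> dist s r < d1 \<Longrightarrow> dist (f s) (f r) < e / B"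
        using uc(1) e B(1) unfolding uniformly_continuous_on_def by (metis divide_pos_pos)
      obtain d2 where d2: "d2 > 0" "\<And>r s. r \<in> {0..T} \<Longrightarrow> s \<in> {0..T} \<Longrightarrow> dist s r < d2 \<Longrightarrow> dist (g s) (g r) < e / B"
        using uc(2) e B(1) unfolding uniformly_continuous_on_def by (metis divide_pos_pos)
      show ?thesis unfolding right_diff_distrib
      proof (rule increment_bound[where d = "min d1 d2"])
        fix r s assume rs: "0 \<le> r" "r \<le> s" "s \<le> t" "s - r < min d1 d2"
        \<comment> \<open>Freezing \<open>g\<close> at the right end and \<open>f\<close> at the
          left end makes the integral of the first two terms exactly
          \<open>h (f s) (g s) - h (f r) (g r)\<close>. What remains against \<open>P\<close>
          contains only oscillations of \<open>f\<close> and \<open>g\<close>.\<close>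
        let ?i = "\<lambda>x. h (f' x) (g s) + h (f r) (g' x) - P x"
        have fi: "(f' has_integral (f s - f r)) {r..s}" and gi: "(g' has_integral (g s - g r)) {r..s}"
          and Pi: "(P has_integral integral {0..s} P - integral {0..r} P) {r..s}"
          and ki: "(k has_integral K s - K r) {r..s}"
          using primitive_on_interval[OF f, of r s] primitive_on_interval[OF g, of r s]
            primitive_on_interval[OF pP, of r s] primitive_on_interval[OF pk, of r s] rs t by auto
        have "(?i has_integral (h (f s - f r) (g s) + h (f r) (g s - g r)
                - (integral {0..s} P - integral {0..r} P))) {r..s}"
          using has_integral_linear[OF fi bounded_linear_left[of "g s"]]
            has_integral_linear[OF gi bounded_linear_right[of "f r"]] Pi
          by (intro has_integral_diff has_integral_add) (auto simp: o_def)
        also have "h (f s - f r) (g s) + h (f r) (g s - g r)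
                - (integral {0..s} P - integral {0..r} P) = D s - D r"
          by (simp add: D_def diff_left diff_right)
        finally have i: "(?i has_integral (D s - D r)) {r..s}" .
        have bd: "norm (?i x) \<le> e * k x" if x: "x \<in> {r..s}" for x
        proof -
          have "?i x = h (f' x) (g s - g x) + h (f r - f x) (g' x)"
            by (simp add: P_def diff_left diff_right)
          also have "norm \<dots> \<le> norm (f' x) * norm (g s - g x) * B + norm (f r - f x) * norm (g' x) * B"
            by (intro norm_triangle_mono B)
          also have "\<dots> \<le> norm (f' x) * (e / B) * B + (e / B) * norm (g' x) * B"
            using d1(2)[of x r] d2(2)[of x s] x rs t B(1)
            by (intro add_mono mult_right_mono mult_left_mono) (auto simp: dist_norm)
          also have "\<dots> = e * k x" using B(1) by (simp add: k_def field_simps)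
          finally show ?thesis .
        qed
        have eki: "((\<lambda>x. e * k x) has_integral e * (K s - K r)) {r..s}"
          by (rule has_integral_mult_right[OF ki])
        have "norm (integral {r..s} ?i) \<le> integral {r..s} (\<lambda>x. e * k x)"
          using i eki bd
          by (intro Henstock_Kurzweil_Integration.integral_norm_bound_integral) auto
        then show "norm (D s - D r) \<le> e * K s - e * K r"
          unfolding integral_unique[OF i] integral_unique[OF eki] by (simp add: right_diff_distrib)
      qed (use t d1 d2 in auto)
    qed
    moreover have "0 \<le> K t - K 0"
    proof -
      have "(k has_integral K t - K 0) {0..t}"
        using primitive_on_interval[OF pk, of 0 t] t by auto
      then show ?thesis
        by (rule has_integral_nonneg) (simp add: k_def)
    qed
    ultimately have "norm (D t - D 0) \<le> 0 + e" if "e > 0" for e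
      using that by (cases "K t - K 0 = 0") (fastforce dest: spec[of _ "e / (K t - K 0)"])+
    then have "norm (D t - D 0) \<le> 0" by (rule field_le_epsilon)
    then show ?thesis by simp
  qed
  have "(P has_integral h (f t) (g t) - h (f 0) (g 0)) {0..t}" if t: "t \<in> {0..T}" for t
  proof -
    have "(P has_integral (0 + integral {0..t} P) - (0 + integral {0..0} P)) {0..t}"
      using primitive_on_interval[OF pP, of 0 t] t by auto
    moreover have "(0 + integral {0..t} P) - (0 + integral {0..0} P) = h (f t) (g t) - h (f 0) (g 0)"
      using D[OF t] by (simp add: D_def algebra_simps)
    ultimately show ?thesis by simp
  qed
  with P show ?thesis by (simp add: primitive_on_def P_def)
qed

lemmas primitive_on_mult = primitive_on_bilinear[OF bounded_bilinear_mult]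

text \<open>By Henstock's lemma the Riemann sums of the norm are small as soon as all interval
  integrals vanish; no almost everywhere differentiation is needed.\<close>
lemma has_integral_norm_zero:
  fixes f :: "real \<Rightarrow> 'a::euclidean_space"
  assumes "\<And>s t. a \<le> s \<Longrightarrow> s \<le> t \<Longrightarrow> t \<le> b \<Longrightarrow> (f has_integral 0) {s..t}"
  shows "((\<lambda>t. norm (f t)) has_integral 0) {a..b}"
proof (cases "a \<le> b")
  case True
  have zero: "integral (cbox s t) f = 0" if "cbox s t \<subseteq> cbox a b" for s t
    using that assms[of s t] by (cases "s \<le> t") (auto simp: cbox_interval)
  have int: "f integrable_on cbox a b"
    using assms[of a b] True by (auto simp: cbox_interval)
  show ?thesis
    unfolding box_real(2)[symmetric] has_integral
  proof (intro allI impI)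
    fix e :: real assume "e > 0"
    obtain G where G: "gauge G" "\<And>p. \<lbrakk>p tagged_partial_division_of (cbox a b); G fine p\<rbrakk> \<Longrightarrow>
             sum (\<lambda>(x,k). norm (Henstock_Kurzweil_Integration.content k *\<^sub>R f x - integral k f)) p < e"
      using Henstock_lemma[OF int \<open>e > 0\<close>] by blast
    show "\<exists>G. gauge G \<and> (\<forall>p. p tagged_division_of cbox a b \<and> G fine p \<longrightarrow>
            norm ((\<Sum>(x, k)\<in>p. Henstock_Kurzweil_Integration.content k *\<^sub>R norm (f x)) - 0) < e)"
    proof (intro exI conjI allI impI)
      fix p assume p: "p tagged_division_of cbox a b \<and> G fine p"
      have "(\<Sum>(x, k)\<in>p. Henstock_Kurzweil_Integration.content k *\<^sub>R norm (f x)) = (\<Sum>(x,k)\<in>p. norm (Henstock_Kurzweil_Integration.content k *\<^sub>R f x - integral k f))"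
      proof (rule sum.cong[OF refl], clarify)
        fix x k assume xk: "(x, k) \<in> p"
        obtain s t where "k = cbox s t" "k \<subseteq> cbox a b"
          using tagged_division_ofD(3,4)[of p "cbox a b" x k] p xk by blast
        then have "integral k f = 0" using zero by blast
        then show "Henstock_Kurzweil_Integration.content k *\<^sub>R norm (f x) = norm (Henstock_Kurzweil_Integration.content k *\<^sub>R f x - integral k f)"
          by simp
      qed
      also have "\<dots> < e"
        using G(2)[of p] p by (auto simp: tagged_division_of_def)
      finally have "(\<Sum>(x, k)\<in>p. Henstock_Kurzweil_Integration.content k *\<^sub>R norm (f x)) < e" .
      moreover have "0 \<le> (\<Sum>(x, k)\<in>p. Henstock_Kurzweil_Integration.content k *\<^sub>R norm (f x))"
        by (rule sum_nonneg) auto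
      ultimately show "norm ((\<Sum>(x, k)\<in>p. Henstock_Kurzweil_Integration.content k *\<^sub>R norm (f x)) - 0) < e" by simp
    qed (fact G)
  qed
qed simp

text \<open>Two densities of the same function differ by one whose integral over every subinterval
  vanishes, so the norm of the difference integrates to zero. This is the source of the independence
  of length from the controls.\<close>

lemma primitive_on_norm_unique:
  assumes f: "primitive_on T f f'" and g: "primitive_on T f g'"
  shows "integral {0..T} (\<lambda>t. norm (f' t)) = integral {0..T} (\<lambda>t. norm (g' t))"
proof -
  have "((\<lambda>t. f' t - g' t) has_integral 0) {s..t}" if "0 \<le> s" "s \<le> t" "t \<le> T" for s t
    using has_integral_diff[OF primitive_on_interval[OF f that] primitive_on_interval[OF g that]]
    by simp
  then have z: "((\<lambda>t. norm (f' t - g' t)) has_integral 0) {0..T}"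
    by (rule has_integral_norm_zero)
  have i: "(\<lambda>t. norm (f' t)) integrable_on {0..T}" "(\<lambda>t. norm (g' t)) integrable_on {0..T}"
    using f g by (auto simp: primitive_on_def absolutely_integrable_on_def)
  have "norm (integral {0..T} (\<lambda>t. norm (f' t) - norm (g' t))) \<le> integral {0..T} (\<lambda>t. norm (f' t - g' t))"
    using i z
    by (intro Henstock_Kurzweil_Integration.integral_norm_bound_integral integrable_diff)
      (auto simp: norm_triangle_ineq3)
  then show ?thesis
    using i z by (auto simp: integral_unique Henstock_Kurzweil_Integration.integral_diff)
qed

section \<open>Linear integral equations with integrable coefficients\<close>

text \<open>Carries the bound \<open>K t ^ n / fact n\<close> to the next iterated integral in the
  Picard series.\<close>

lemma primitive_on_power_Suc:
  fixes K :: "real \<Rightarrow> real"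
  assumes "primitive_on T K k"
  shows "primitive_on T (\<lambda>t. K t ^ Suc n) (\<lambda>t. real (Suc n) * K t ^ n * k t)"
proof (induction n)
  case (Suc n)
  show ?case
    by (rule primitive_on_cong[OF primitive_on_mult[OF assms Suc]])
      (auto simp: algebra_simps)
qed (use assms in simp)

text \<open>Picard series with an integrable majorant: \<open>k s\<close> bounds the operator norm
  of \<open>A s\<close>, and with \<open>K\<close> its integral the \<open>n\<close>-th iterated
  integral is at most \<open>norm x0 * K t ^ n / fact n\<close>. The series thus converges
  uniformly, and dominated convergence with majorant \<open>suminf E * k\<close> passes to the limit
  under the integral.\<close>

lemma linear_ode_exists:
  fixes L1 L2 :: "'a::euclidean_space \<Rightarrow> 'a"
  assumes L1: "bounded_linear L1" and L2: "bounded_linear L2"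
    and u1: "u1 absolutely_integrable_on {0..T}" and u2: "u2 absolutely_integrable_on {0..T}"
  obtains x where "x 0 = x0" "primitive_on T x (\<lambda>s. u1 s *\<^sub>R L1 (x s) + u2 s *\<^sub>R L2 (x s))"
proof -
  interpret L1: bounded_linear L1 by fact
  interpret L2: bounded_linear L2 by fact
  obtain B1 where B1: "B1 > 0" "\<And>a. norm (L1 a) \<le> norm a * B1"
    using L1.pos_bounded by blast
  obtain B2 where B2: "B2 > 0" "\<And>a. norm (L2 a) \<le> norm a * B2"
    using L2.pos_bounded by blast
  define A where "A s a = u1 s *\<^sub>R L1 a + u2 s *\<^sub>R L2 a" for s a
  define k where "k s = B1 * \<bar>u1 s\<bar> + B2 * \<bar>u2 s\<bar>" for s
  have A_bound: "norm (A s a) \<le> k s * norm a" for s a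
  proof -
    have "norm (A s a) \<le> \<bar>u1 s\<bar> * norm (L1 a) + \<bar>u2 s\<bar> * norm (L2 a)"
      unfolding A_def by (metis norm_scaleR norm_triangle_ineq)
    also have "\<dots> \<le> \<bar>u1 s\<bar> * (norm a * B1) + \<bar>u2 s\<bar> * (norm a * B2)"
      by (intro add_mono mult_left_mono B1 B2) auto
    finally show ?thesis by (simp add: k_def algebra_simps)
  qed
  have A_sum: "A s (sum F I) = (\<Sum>i\<in>I. A s (F i))" for s F and I :: "nat set"
    by (simp add: A_def L1.sum L2.sum scaleR_sum_right sum.distrib)
  have A_cont: "bounded_linear (A s)" for s
    unfolding A_def by (intro bounded_linear_intros L1 L2)
  have k_nonneg: "0 \<le> k s" for s using B1(1) B2(1) by (simp add: k_def)
  have k: "k absolutely_integrable_on {0..T}"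
    unfolding k_def
    using absolutely_integrable_norm[OF u1] absolutely_integrable_norm[OF u2]
    by (intro set_integral_add set_integrable_mult_right) (auto simp: o_def)
  define K where "K t = 0 + integral {0..t} k" for t
  have K: "primitive_on T K k"
    unfolding K_def by (rule primitive_on_integral[OF k])
  have K_mono: "0 \<le> K t \<and> K t \<le> K T" if t: "t \<in> {0..T}" for t
  proof -
    have "0 \<le> K t - K 0" "0 \<le> K T - K t"
      using has_integral_nonneg[OF primitive_on_interval[OF K, of 0 t]]
        has_integral_nonneg[OF primitive_on_interval[OF K, of t T]] t k_nonneg by auto
    then show ?thesis by (simp add: K_def)
  qed
  have AI: "(\<lambda>s. A s (x s)) absolutely_integrable_on {0..T}" if x: "continuous_on {0..T} x" for x
  proof -
    have c: "continuous_on {0..T} (\<lambda>s. L1 (x s))" "continuous_on {0..T} (\<lambda>s. L2 (x s))"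
      by (intro L1.continuous_on L2.continuous_on x)+
    show ?thesis
      unfolding A_def
      by (intro set_integral_add
          absolutely_integrable_bilinear[OF bounded_bilinear.flip[OF bounded_bilinear_scaleR]] c u1 u2)
  qed
  \<comment> \<open>\<open>X n\<close> is the \<open>n\<close>-th increment of the Picard iteration,
    not the iterate itself. The \<open>0 +\<close> gives it the shape of
    \<open>primitive_on_integral\<close>.\<close>
  define X where "X = rec_nat (\<lambda>t. x0) (\<lambda>n f t. 0 + integral {0..t} (\<lambda>s. A s (f s)))"
  have X0: "X 0 = (\<lambda>t. x0)" and XS: "X (Suc n) = (\<lambda>t. 0 + integral {0..t} (\<lambda>s. A s (X n s)))" for n
    by (simp_all add: X_def)
  have XC: "continuous_on {0..T} (X n)" for n
  proof (induction n)
    case (Suc n)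
    from primitive_on_continuous[OF primitive_on_integral[OF AI[OF this], of 0]]
    show ?case by (simp add: XS)
  qed (simp add: X0)
  have XP: "primitive_on T (X (Suc n)) (\<lambda>s. A s (X n s))" for n
    unfolding XS by (rule primitive_on_integral[OF AI[OF XC]])
  have X_bound: "norm (X n t) \<le> norm x0 * (K t ^ n / fact n)" if "t \<in> {0..T}" for n t
    using that
  proof (induction n arbitrary: t)
    case (Suc n)
    let ?c = "norm x0 / fact (Suc n)"
    have i: "((\<lambda>s. A s (X n s)) has_integral X (Suc n) t) {0..t}"
      using XP[of n] Suc.prems by (auto simp: primitive_on_def XS)
    have j: "((\<lambda>s. ?c * (real (Suc n) * K s ^ n * k s)) has_integral ?c * K t ^ Suc n) {0..t}"
      using primitive_on_power_Suc[OF K, of n] Suc.prems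
      by (intro has_integral_mult_right) (auto simp: primitive_on_def K_def)
    have "norm (integral {0..t} (\<lambda>s. A s (X n s))) \<le> integral {0..t} (\<lambda>s. ?c * (real (Suc n) * K s ^ n * k s))"
    proof (rule Henstock_Kurzweil_Integration.integral_norm_bound_integral)
      fix s assume s: "s \<in> {0..t}"
      have "norm (A s (X n s)) \<le> k s * norm (X n s)" by (rule A_bound)
      also have "\<dots> \<le> k s * (norm x0 * (K s ^ n / fact n))"
        using s Suc.prems by (intro mult_left_mono k_nonneg Suc.IH) auto
      also have "\<dots> = ?c * (real (Suc n) * K s ^ n * k s)"
        by (simp add: divide_simps)
      finally show "norm (A s (X n s)) \<le> \<dots>" .
    qed (use i j in auto)
    then show ?case
      using integral_unique[OF i] integral_unique[OF j] by simp
  qed (simp add: X0)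
  define E where "E n = norm x0 * (K T ^ n / fact n)" for n
  have E_sum: "summable E"
    unfolding E_def using summable_exp_generic[of "K T"]
    by (intro summable_mult) (simp add: divide_inverse mult.commute)
  have XE: "norm (X n t) \<le> E n" if t: "t \<in> {0..T}" for n t
    using X_bound[OF t, of n] K_mono[OF t]
    by (auto simp: E_def intro!: order_trans[OF X_bound[OF t]] mult_left_mono divide_right_mono power_mono)
  define x where "x t = (\<Sum>n. X n t)" for t
  have summ: "summable (\<lambda>n. X n t)" if "t \<in> {0..T}" for t
    by (rule summable_comparison_test'[OF E_sum]) (use XE that in auto)
  have lim: "(\<lambda>N. \<Sum>n<N. X n t) \<longlonglongrightarrow> x t" if "t \<in> {0..T}" for t
    unfolding x_def by (rule summable_LIMSEQ[OF summ[OF that]])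
  define S where "S N s = A s (\<Sum>n<N. X n s)" for N s
  have S_lim: "(\<lambda>N. S N s) \<longlonglongrightarrow> A s (x s)" if "s \<in> {0..T}" for s
    unfolding S_def by (rule bounded_linear.tendsto[OF A_cont lim[OF that]])
  have S_ai: "S N absolutely_integrable_on {0..T}" for N
    unfolding S_def by (intro AI continuous_on_sum XC)
  have E_nonneg: "0 \<le> E n" if "0 \<le> T" for n
    using that K_mono[of T] by (simp add: E_def)
  have S_bound: "norm (S N s) \<le> suminf E * k s" if s: "s \<in> {0..T}" for N s
  proof -
    have "norm (\<Sum>n<N. X n s) \<le> (\<Sum>n<N. E n)"
      by (rule sum_norm_le) (use XE s in auto)
    also have "\<dots> \<le> suminf E"
      using E_nonneg s by (intro sum_le_suminf E_sum) auto
    finally have "k s * norm (\<Sum>n<N. X n s) \<le> k s * suminf E"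
      by (intro mult_left_mono k_nonneg)
    with A_bound[of s "\<Sum>n<N. X n s"] show ?thesis
      by (simp add: S_def mult.commute)
  qed
  have dom: "(\<lambda>s. suminf E * k s) integrable_on {0..T}"
    using k by (intro integrable_on_mult_right) (simp add: absolutely_integrable_on_def)
  have Ax: "norm (A s (x s)) \<le> suminf E * k s" if "s \<in> {0..T}" for s
    by (rule LIMSEQ_le_const2[OF tendsto_norm[OF S_lim[OF that]]]) (use S_bound that in auto)
  have ai: "(\<lambda>s. A s (x s)) absolutely_integrable_on {0..T}"
    by (rule dominated_convergence_absolutely_integrable[OF S_ai dom Ax S_lim])
  \<comment> \<open>Integration shifts the index: applying \<open>A\<close> to terms
    \<open>0\<close> to \<open>N - 1\<close> and integrating yields terms \<open>1\<close> to
    \<open>N\<close>. The missing term \<open>X 0\<close> is \<open>x0\<close>, hence the difference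
    \<open>x t - x0\<close> in the limit.\<close>
  have S_prim: "primitive_on T (\<lambda>t. \<Sum>n<N. X (Suc n) t) (S N)" for N
    unfolding S_def A_sum by (rule primitive_on_sum) (rule XP)
  have prim: "((\<lambda>s. A s (x s)) has_integral x t - x0) {0..t}" if t: "t \<in> {0..T}" for t
  proof -
    have sub: "{0..t} \<subseteq> {0..T}" using t by auto
    have Si: "(S N has_integral (\<Sum>n<N. X (Suc n) t)) {0..t}" for N
      using S_prim[of N] t by (auto simp: primitive_on_def XS)
    have dom': "(\<lambda>s. suminf E * k s) integrable_on {0..t}"
      by (rule integrable_subinterval_real[OF dom sub])
    have S_int: "S N integrable_on {0..t}" for N using Si by blast
    note dc = dominated_convergence[of S, OF S_int dom', where g = "\<lambda>s. A s (x s)"]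
    have conv: "(\<lambda>N. integral {0..t} (S N)) \<longlonglongrightarrow> integral {0..t} (\<lambda>s. A s (x s))"
      by (rule dc(2)) (use S_bound S_lim sub in auto)
    have int: "(\<lambda>s. A s (x s)) integrable_on {0..t}"
      by (rule dc(1)) (use S_bound S_lim sub in auto)
    have "(\<lambda>N. (\<Sum>n<Suc N. X n t) - x0) \<longlonglongrightarrow> x t - x0"
      by (intro tendsto_intros LIMSEQ_Suc lim t)
    moreover have "(\<Sum>n<Suc N. X n t) - x0 = integral {0..t} (S N)" for N
      using integral_unique[OF Si[of N]] by (simp add: sum.lessThan_Suc_shift X0 del: sum.lessThan_Suc)
    ultimately have "(\<lambda>N. integral {0..t} (S N)) \<longlonglongrightarrow> x t - x0" by simp
    with conv have "integral {0..t} (\<lambda>s. A s (x s)) = x t - x0"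
      by (rule LIMSEQ_unique)
    with int show ?thesis by (simp add: has_integral_iff)
  qed
  have X_at_0: "X n 0 = (if n = 0 then x0 else 0)" for n
    by (cases n) (simp_all add: X0 XS)
  have x_at_0: "x 0 = x0"
    using suminf_finite[of "{0}" "\<lambda>n. X n 0"] by (simp add: x_def X_at_0)
  show thesis
  proof (rule that)
    show "primitive_on T x (\<lambda>s. u1 s *\<^sub>R L1 (x s) + u2 s *\<^sub>R L2 (x s))"
      using ai prim unfolding A_def primitive_on_def by (auto simp: x_at_0)
  qed (fact x_at_0)
qed

section \<open>Coordinates and frames on SU(2)\<close>

lemma mat2_nth [simp]:
  "mat2 a b c d $ 1 $ 1 = a" "mat2 a b c d $ 1 $ 2 = b"
  "mat2 a b c d $ 2 $ 1 = c" "mat2 a b c d $ 2 $ 2 = d"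
  by (simp_all add: mat2_def)

lemma cmat_eq_iff:
  "(g :: cmat) = h \<longleftrightarrow> g $ 1 $ 1 = h $ 1 $ 1 \<and> g $ 1 $ 2 = h $ 1 $ 2 \<and> g $ 2 $ 1 = h $ 2 $ 1 \<and> g $ 2 $ 2 = h $ 2 $ 2"
  by (auto simp: vec_eq_iff forall_2)

lemma matrix_mult_nth2: "((A :: cmat) ** (B :: cmat)) $ i $ j = A $ i $ 1 * B $ 1 $ j + A $ i $ 2 * B $ 2 $ j"
  by (simp add: matrix_matrix_mult_def sum_2)

lemma mat_nth2 [simp]: "(mat x :: cmat) $ i $ j = (if i = j then x else 0)"
  by (simp add: mat_def)

lemma scaleR_matrix_mult: "(x *\<^sub>R (A :: cmat)) ** (B :: cmat) = x *\<^sub>R (A ** B)"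
  by (simp add: cmat_eq_iff matrix_mult_nth2 algebra_simps)

lemma matrix_mult_scaleR: "(A :: cmat) ** (x *\<^sub>R (B :: cmat)) = x *\<^sub>R (A ** B)"
  by (simp add: cmat_eq_iff matrix_mult_nth2 algebra_simps)

text \<open>The powers of \<open>J\<close> cycle like those of the imaginary unit, so the
  exponential series splits into the cosine and sine series.\<close>

lemma mexp_complex_structure:
  fixes J :: cmat
  assumes J: "J ** J = - mat 1"
  shows "mexp (x *\<^sub>R J) = cos x *\<^sub>R mat 1 + sin x *\<^sub>R J"
proof -
  have terms: "(1 / fact n) *\<^sub>R matpow (x *\<^sub>R J) n =
      (cos_coeff n * x ^ n) *\<^sub>R mat 1 + (sin_coeff n * x ^ n) *\<^sub>R J" for n
  proof (induction n)
    case (Suc n)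
    have "(1 / fact (Suc n)) *\<^sub>R matpow (x *\<^sub>R J) (Suc n) =
        (x / real (Suc n)) *\<^sub>R (J ** ((1 / fact n) *\<^sub>R matpow (x *\<^sub>R J) n))"
      by (simp add: matpow_def scaleR_matrix_mult matrix_mult_scaleR divide_simps del: of_nat_Suc)
    also have "\<dots> = (x / real (Suc n)) *\<^sub>R ((cos_coeff n * x ^ n) *\<^sub>R J - (sin_coeff n * x ^ n) *\<^sub>R mat 1)"
      unfolding Suc matrix_add_ldistrib matrix_mult_scaleR J by simp
    also have "\<dots> = (cos_coeff (Suc n) * x ^ Suc n) *\<^sub>R mat 1 + (sin_coeff (Suc n) * x ^ Suc n) *\<^sub>R J"
      by (simp add: cos_coeff_Suc sin_coeff_Suc scaleR_diff_right algebra_simps del: of_nat_Suc)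
    finally show ?case .
  qed (simp add: matpow_def cos_coeff_def sin_coeff_def)
  have "(\<lambda>n. (cos_coeff n * x ^ n) *\<^sub>R mat 1 + (sin_coeff n * x ^ n) *\<^sub>R J) sums
      (cos x *\<^sub>R mat 1 + sin x *\<^sub>R J)"
    using cos_converges[of x] sin_converges[of x]
    by (intro sums_add sums_scaleR_left) auto
  then show ?thesis
    unfolding mexp_def terms by (simp add: sums_iff)
qed

text \<open>The quaternion with real coordinates \<open>p\<close>, \<open>q\<close>,
  \<open>r\<close>, \<open>s\<close> with respect to the units \<open>mat 1\<close>,
  \<open>2 p2\<close>, \<open>2 p1\<close> and \<open>4 p1 p2 = 2 [p1, p2]\<close>.\<close>

definition quat :: "real \<Rightarrow> real \<Rightarrow> real \<Rightarrow> real \<Rightarrow> cmat" where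
  "quat p q r s = mat2 (Complex p s) (Complex r q) (Complex (- r) q) (Complex p (- s))"

lemma quat_eq_iff: "quat p q r s = quat p' q' r' s' \<longleftrightarrow> p = p' \<and> q = q' \<and> r = r' \<and> s = s'"
  by (auto simp: quat_def cmat_eq_iff complex_eq_iff)

text \<open>The factor 1/2 in \<open>p1\<close> means that \<open>2 p1\<close>, not
  \<open>p1\<close>, squares to minus one; hence the half-angles here and for
  \<open>p2\<close>.\<close>

lemma mexp_p1: "mexp (a *\<^sub>R p1) = quat (cos (a / 2)) 0 (sin (a / 2)) 0"
proof -
  have "(2 *\<^sub>R p1) ** (2 *\<^sub>R p1) = - mat 1"
    by (simp add: p1_def cmat_eq_iff matrix_mult_nth2 complex_eq_iff)
  from mexp_complex_structure[OF this, of "a / 2"] show ?thesis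
    by (simp add: quat_def cmat_eq_iff p1_def complex_eq_iff)
qed

lemma mexp_p2: "mexp (c *\<^sub>R p2) = quat (cos (c / 2)) (sin (c / 2)) 0 0"
proof -
  have "(2 *\<^sub>R p2) ** (2 *\<^sub>R p2) = - mat 1"
    by (simp add: p2_def cmat_eq_iff matrix_mult_nth2 complex_eq_iff)
  from mexp_complex_structure[OF this, of "c / 2"] show ?thesis
    by (simp add: quat_def cmat_eq_iff p2_def complex_eq_iff)
qed

lemma quat_mult:
  "quat p q r s ** quat p' q' r' s' =
   quat (p * p' - q * q' - r * r' - s * s') (p * q' + q * p' - r * s' + s * r')
        (p * r' + r * p' + q * s' - s * q') (p * s' + s * p' + r * q' - q * r')"
  by (simp add: quat_def cmat_eq_iff matrix_mult_nth2 complex_eq_iff algebra_simps)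

text \<open>\<open>p2\<close> anticommutes with \<open>p1\<close>, so moving the left exponential
  past \<open>p1\<close> reverses the sign of \<open>b\<close>. The pair \<open>(p, q)\<close>
  therefore has angle \<open>(c - b) / 2\<close> and the pair \<open>(r, s)\<close> has angle
  \<open>(c + b) / 2\<close>.\<close>

lemma coords_iff:
  "coords g a b c \<longleftrightarrow> 0 \<le> a \<and> a \<le> pi \<and> 0 \<le> b \<and> b < 2 * pi \<and>
     g = quat (cos (a / 2) * cos (c / 2 - b / 2)) (cos (a / 2) * sin (c / 2 - b / 2))
              (sin (a / 2) * cos (b / 2 + c / 2)) (sin (a / 2) * sin (b / 2 + c / 2))"
proof -
  have "mexp ((- b) *\<^sub>R p2) ** mexp (a *\<^sub>R p1) ** mexp (c *\<^sub>R p2) =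
      quat (cos (a / 2) * cos (c / 2 - b / 2)) (cos (a / 2) * sin (c / 2 - b / 2))
              (sin (a / 2) * cos (b / 2 + c / 2)) (sin (a / 2) * sin (b / 2 + c / 2))"
    unfolding mexp_p1 mexp_p2 quat_mult quat_eq_iff
    by (simp add: cos_diff sin_diff cos_add sin_add algebra_simps)
  then show ?thesis by (simp add: coords_def)
qed

text \<open>Unitarity and determinant one force the second row to be the conjugate transform of the
  first. What remains is the unit sphere in the quaternions.\<close>

lemma SU2_iff: "g \<in> SU2 \<longleftrightarrow> (\<exists>p q r s. g = quat p q r s \<and> p\<^sup>2 + q\<^sup>2 + r\<^sup>2 + s\<^sup>2 = 1)"
proof
  assume "g \<in> SU2"
  then have u: "g ** adjoint_mat g = mat 1" and d: "det g = 1" by (auto simp: SU2_def)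
  obtain \<alpha> \<beta> \<gamma> \<delta> where g: "g = mat2 \<alpha> \<beta> \<gamma> \<delta>"
    by (metis cmat_eq_iff mat2_nth)
  have 1: "\<alpha> * cnj \<alpha> + \<beta> * cnj \<beta> = 1" and 2: "\<gamma> * cnj \<alpha> + \<delta> * cnj \<beta> = 0"
    using u by (auto simp: g cmat_eq_iff matrix_mult_nth2 adjoint_mat_def)
  have 3: "\<alpha> * \<delta> - \<beta> * \<gamma> = 1" using d by (simp add: g det_2)
  have "\<delta> = cnj \<alpha>" "\<gamma> = - cnj \<beta>"
    using 1 2 3 by algebra+
  with g have "g = quat (Re \<alpha>) (Im \<beta>) (Re \<beta>) (Im \<alpha>)"
    by (simp add: quat_def cmat_eq_iff complex_eq_iff)
  moreover have "(Re \<alpha>)\<^sup>2 + (Im \<beta>)\<^sup>2 + (Re \<beta>)\<^sup>2 + (Im \<alpha>)\<^sup>2 = 1"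
    using 1 by (simp add: complex_eq_iff power2_eq_square)
  ultimately show "\<exists>p q r s. g = quat p q r s \<and> p\<^sup>2 + q\<^sup>2 + r\<^sup>2 + s\<^sup>2 = 1" by blast
next
  assume "\<exists>p q r s. g = quat p q r s \<and> p\<^sup>2 + q\<^sup>2 + r\<^sup>2 + s\<^sup>2 = 1"
  then show "g \<in> SU2"
    by (auto simp: SU2_def quat_def cmat_eq_iff matrix_mult_nth2 adjoint_mat_def det_2 complex_eq_iff
        power2_eq_square algebra_simps)
qed

section \<open>Orthonormal frames of unit quaternions\<close>

lemma vec3_eq_iff: "(x :: 'a ^ 3) = y \<longleftrightarrow> x $ 1 = y $ 1 \<and> x $ 2 = y $ 2 \<and> x $ 3 = y $ 3"
  by (simp add: vec_eq_iff forall_3)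

lemma inner_vec3: "(x :: real ^ 3) \<bullet> y = x $ 1 * y $ 1 + x $ 2 * y $ 2 + x $ 3 * y $ 3"
  by (simp add: inner_vec_def sum_3)

lemma norm_eq_1_vec3: "norm (x :: real ^ 3) = 1 \<longleftrightarrow> (x $ 1)\<^sup>2 + (x $ 2)\<^sup>2 + (x $ 3)\<^sup>2 = 1"
  by (simp add: norm_eq_1 inner_vec3 power2_eq_square)

lemma cross3_nth:
  "cross3 x y $ 1 = x $ 2 * y $ 3 - x $ 3 * y $ 2"
  "cross3 x y $ 2 = x $ 3 * y $ 1 - x $ 1 * y $ 3"
  "cross3 x y $ 3 = x $ 1 * y $ 2 - x $ 2 * y $ 1"
  by (simp_all add: cross3_simps)

text \<open>The vectors \<open>base g\<close> and \<open>dir g\<close> are the images of \<open>p2\<close> and \<open>[p1, p2]\<close> under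
  \<open>Ad g\<close>, in the basis \<open>[p1, p2], - p1, p2\<close> of the Lie algebra.\<close>
definition base :: "cmat \<Rightarrow> real^3" where
  "base g = (let p = Re (g $ 1 $ 1); q = Im (g $ 1 $ 2); r = Re (g $ 1 $ 2); s = Im (g $ 1 $ 1) in
     vector [2 * (r * p + s * q), 2 * (s * p - r * q), p * p + q * q - r * r - s * s])"

definition dir :: "cmat \<Rightarrow> real^3" where
  "dir g = (let p = Re (g $ 1 $ 1); q = Im (g $ 1 $ 2); r = Re (g $ 1 $ 2); s = Im (g $ 1 $ 1) in
     vector [p * p - q * q - r * r + s * s, - 2 * (p * q + r * s), 2 * (s * q - r * p)])"

lemma base_quat:
  "base (quat p q r s) = vector [2 * (r * p + s * q), 2 * (s * p - r * q), p * p + q * q - r * r - s * s]"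
  by (simp add: base_def quat_def)

lemma dir_quat:
  "dir (quat p q r s) = vector [p * p - q * q - r * r + s * s, - 2 * (p * q + r * s), 2 * (s * q - r * p)]"
  by (simp add: dir_def quat_def)

lemma frame_SU2:
  assumes "g \<in> SU2"
  shows "norm (base g) = 1" "norm (dir g) = 1" "base g \<bullet> dir g = 0"
proof -
  obtain p q r s where g: "g = quat p q r s" and 1: "p\<^sup>2 + q\<^sup>2 + r\<^sup>2 + s\<^sup>2 = 1"
    using assms by (auto simp: SU2_iff)
  show "norm (base g) = 1"
    unfolding g norm_eq_1_vec3 base_quat vector_3 using 1 by algebra
  show "norm (dir g) = 1"
    unfolding g norm_eq_1_vec3 dir_quat vector_3 using 1 by algebra
  show "base g \<bullet> dir g = 0"
    unfolding g inner_vec3 base_quat dir_quat vector_3 by algebra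
qed

text \<open>Inverts the Euler-Rodrigues parametrisation: the entries of a rotation matrix determine
  all products of two quaternion coordinates, hence the quaternion up to sign.\<close>

lemma quat_products:
  assumes 1: "p\<^sup>2 + q\<^sup>2 + r\<^sup>2 + s\<^sup>2 = 1"
  defines "y \<equiv> base (quat p q r s)" and "v \<equiv> dir (quat p q r s)"
  defines "w \<equiv> cross3 y v"
  shows "4 * (p * p) = 1 + y $ 3 + v $ 1 + w $ 2" "4 * (q * q) = 1 + y $ 3 - v $ 1 - w $ 2"
    "4 * (r * r) = 1 - y $ 3 - v $ 1 + w $ 2" "4 * (s * s) = 1 - y $ 3 + v $ 1 - w $ 2"
    "4 * (p * q) = w $ 1 - v $ 2" "4 * (r * s) = - w $ 1 - v $ 2"
    "4 * (p * s) = y $ 2 - w $ 3" "4 * (q * r) = - y $ 2 - w $ 3"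
    "4 * (p * r) = y $ 1 - v $ 3" "4 * (q * s) = y $ 1 + v $ 3"
  unfolding w_def y_def v_def cross3_nth base_quat dir_quat vector_3
  using 1 by algebra+

lemma quat_uminus: "- quat p q r s = quat (- p) (- q) (- r) (- s)"
  by (simp add: quat_def cmat_eq_iff complex_eq_iff)

text \<open>Equal frames give equal products of coordinates. With \<open>d\<close> the inner product
  of the two quaternions, these products yield that the second is \<open>d\<close> times the first
  and that \<open>d\<close> has square one.\<close>

lemma frame_determines:
  assumes "g \<in> SU2" "h \<in> SU2" "base g = base h" "dir g = dir h"
  shows "h = g \<or> h = - g"
proof -
  obtain p q r s where g: "g = quat p q r s" and 1: "p\<^sup>2 + q\<^sup>2 + r\<^sup>2 + s\<^sup>2 = 1"
    using assms by (auto simp: SU2_iff)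
  obtain p' q' r' s' where h: "h = quat p' q' r' s'" and 2: "p'\<^sup>2 + q'\<^sup>2 + r'\<^sup>2 + s'\<^sup>2 = 1"
    using assms by (auto simp: SU2_iff)
  have eq: "p * p = p' * p'" "q * q = q' * q'" "r * r = r' * r'" "s * s = s' * s'"
    "p * q = p' * q'" "r * s = r' * s'" "p * s = p' * s'" "q * r = q' * r'" "p * r = p' * r'" "q * s = q' * s'"
    using quat_products[OF 1] quat_products[OF 2] assms(3,4) unfolding g h by auto
  define d where "d = p * p' + q * q' + r * r' + s * s'"
  have "p' = d * p" "q' = d * q" "r' = d * r" "s' = d * s"
    using eq 2 unfolding d_def power2_eq_square by algebra+
  moreover have "d\<^sup>2 = 1"
    using eq 1 2 unfolding d_def power2_eq_square by algebra
  ultimately show ?thesis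
    unfolding g h quat_uminus quat_eq_iff by (auto simp: power2_eq_1_iff)
qed

lemma coords_SU2: "coords g a b c \<Longrightarrow> g \<in> SU2"
proof -
  assume "coords g a b c"
  moreover have "(x * cos t)\<^sup>2 + (x * sin t)\<^sup>2 = x\<^sup>2" for x t :: real
    using sin_cos_squared_add[of t] by algebra
  ultimately show ?thesis
    unfolding SU2_iff coords_iff by (metis sin_cos_squared_add2 add.assoc)
qed

text \<open>Rewrite rules eliminating squares of cosines; the second form reaches a square inside a
  longer, right-nested product.\<close>

lemma cos_reduce: "cos t * cos t = 1 - sin t * sin t" "cos t * (cos t * x) = x - sin t * (sin t * x)" for t x :: real
  using sin_cos_squared_add[of t] by algebra+

lemma coords_frame:
  assumes "coords g a b c"
  shows "base g = sph a b" "dir g = cos c *\<^sub>R e_a a b - sin c *\<^sub>R e_b a b"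
proof -
  \<comment> \<open>Expressed in these half-angles, \<open>a\<close>, \<open>b\<close> and
    \<open>c\<close> are sums and differences, so the addition formulas reduce both claims to
    polynomial identities in sines and cosines.\<close>
  define A t f where "A = a / 2" and "t = c / 2 - b / 2" and "f = b / 2 + c / 2"
  have a: "a = A + A" and b: "b = f - t" and c: "c = f + t"
    by (simp_all add: A_def t_def f_def field_simps)
  have g: "g = quat (cos A * cos t) (cos A * sin t) (sin A * cos f) (sin A * sin f)"
    using assms by (simp add: coords_iff A_def t_def f_def)
  show "base g = sph a b"
    unfolding g base_quat sph_def vec3_eq_iff vector_3 a b c cos_add sin_add cos_diff sin_diff
    by (simp add: algebra_simps cos_reduce)
  show "dir g = cos c *\<^sub>R e_a a b - sin c *\<^sub>R e_b a b"
    unfolding g dir_quat e_a_def e_b_def vec3_eq_iff vector_minus_component vector_scaleR_component vector_3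
      a b c cos_add sin_add cos_diff sin_diff real_scaleR_def
    by (simp add: algebra_simps cos_reduce)
qed

lemma sph_exists:
  assumes "norm y = 1"
  obtains a b where "0 \<le> a" "a \<le> pi" "0 \<le> b" "b < 2 * pi" "y = sph a b"
proof -
  have y: "(y $ 1)\<^sup>2 + (y $ 2)\<^sup>2 + (y $ 3)\<^sup>2 = 1" using assms by (simp add: norm_eq_1_vec3)
  then have y3: "\<bar>y $ 3\<bar> \<le> 1"
    by (metis abs_square_le_1 le_add_same_cancel2 sum_power2_ge_zero)
  define z where "z = Complex (y $ 1) (y $ 2)"
  \<comment> \<open>\<open>Arg\<close> takes values in the interval from \<open>- pi\<close> to
    \<open>pi\<close>; negative ones are moved into the required range. At a pole
    \<open>z = 0\<close>, and any angle serves.\<close>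
  define b where "b = (if 0 \<le> Arg z then Arg z else Arg z + 2 * pi)"
  have b: "0 \<le> b" "b < 2 * pi" and cisb: "cis b = cis (Arg z)"
    using Arg_bounded[of z] pi_gt_zero by (auto simp: b_def cis.ctr)
  have z: "z = cmod z * cis b" unfolding cisb by (metis rcis_cmod_Arg rcis_def)
  have "cmod z = sqrt (1 - (y $ 3)\<^sup>2)"
    using y by (simp add: z_def cmod_def algebra_simps)
  then have s: "sin (arccos (y $ 3)) = cmod z"
    using y3 by (simp add: sin_arccos_abs)
  have "y $ 1 = cmod z * cos b" "y $ 2 = cmod z * sin b"
    using arg_cong[OF z, of Re] arg_cong[OF z, of Im] by (simp_all add: z_def)
  then have "y = sph (arccos (y $ 3)) b"
    using y3 s by (simp add: sph_def vec3_eq_iff)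
  with b y3 show thesis
    by (intro that[of "arccos (y $ 3)" b]) (auto simp: arccos_lbound arccos_ubound)
qed

lemma tangent_exists:
  assumes "norm v = 1" "sph a b \<bullet> v = 0"
  obtains c where "v = cos c *\<^sub>R e_a a b - sin c *\<^sub>R e_b a b"
proof -
  have 1: "(sin a)\<^sup>2 + (cos a)\<^sup>2 = 1" "(sin b)\<^sup>2 + (cos b)\<^sup>2 = 1" by simp_all
  have v: "(v $ 1)\<^sup>2 + (v $ 2)\<^sup>2 + (v $ 3)\<^sup>2 = 1" using assms by (simp add: norm_eq_1_vec3)
  have o: "sin a * cos b * v $ 1 + sin a * sin b * v $ 2 + cos a * v $ 3 = 0"
    using assms(2) by (simp add: inner_vec3 sph_def)
  \<comment> \<open>The components of \<open>v\<close> along \<open>e_a\<close> and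
    \<open>- e_b\<close>; the second sign makes the angle come out as \<open>- c\<close>.\<close>
  define x y where "x = cos a * cos b * v $ 1 + cos a * sin b * v $ 2 - sin a * v $ 3"
    and "y = sin b * v $ 1 - cos b * v $ 2"
  have "x\<^sup>2 + y\<^sup>2 = 1" unfolding x_def y_def using v o 1 by algebra
  then obtain c where c: "x = cos c" "y = sin c" using sincos_total_2pi by metis
  have "v = x *\<^sub>R e_a a b - y *\<^sub>R e_b a b"
    unfolding e_a_def e_b_def vec3_eq_iff vector_minus_component vector_scaleR_component vector_3 real_scaleR_def
      x_def y_def
    using o 1 by - (intro conjI; algebra)
  with c that show thesis by simp
qed

lemma quat_SU2: "p\<^sup>2 + q\<^sup>2 + r\<^sup>2 + s\<^sup>2 = 1 \<Longrightarrow> quat p q r s \<in> SU2"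
  by (auto simp: SU2_iff)

lemma coords_exists:
  assumes "0 \<le> a" "a \<le> pi" "0 \<le> b" "b < 2 * pi"
  shows "\<exists>g. coords g a b c"
  using assms by (simp add: coords_iff)

lemma frame_exists:
  assumes "norm y = 1" "norm v = 1" "y \<bullet> v = 0"
  obtains g where "g \<in> SU2" "base g = y" "dir g = v"
proof -
  obtain a b where ab: "0 \<le> a" "a \<le> pi" "0 \<le> b" "b < 2 * pi" "y = sph a b"
    using sph_exists[OF assms(1)] by blast
  obtain c where c: "v = cos c *\<^sub>R e_a a b - sin c *\<^sub>R e_b a b"
    using tangent_exists assms(2,3) ab(5) by blast
  obtain g where "coords g a b c" using coords_exists ab by blast
  with that ab(5) c show thesis using coords_SU2 coords_frame by metis
qed

text \<open>The exponential of \<open>2 * pi\<close> times \<open>p2\<close> is minus the identity;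
  this is why the period of \<open>c\<close> is \<open>4 * pi\<close>.\<close>

lemma coords_uminus:
  assumes "coords g a b c"
  shows "coords (- g) a b (c + 2 * pi)"
proof -
  have "(c + 2 * pi) / 2 - b / 2 = c / 2 - b / 2 + pi" "b / 2 + (c + 2 * pi) / 2 = b / 2 + c / 2 + pi"
    by (simp_all add: field_simps)
  with assms show ?thesis
    unfolding coords_iff by (simp only: quat_uminus) simp
qed

text \<open>Any pair \<open>a\<close>, \<open>b\<close> describing the base point can be completed
  to coordinates of \<open>g\<close>, even at a pole. This matters because \<open>approx\<close>
  asks two matrices to share \<open>a\<close> and \<open>b\<close>.\<close>

lemma coords_with_base:
  assumes g: "g \<in> SU2" and ab: "0 \<le> a" "a \<le> pi" "0 \<le> b" "b < 2 * pi" and y: "base g = sph a b"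
  obtains c where "coords g a b c"
proof -
  obtain c where c: "dir g = cos c *\<^sub>R e_a a b - sin c *\<^sub>R e_b a b"
    using tangent_exists frame_SU2[OF g] y by metis
  obtain h where h: "coords h a b c" using coords_exists ab by blast
  then have "g = h \<or> g = - h"
    using frame_determines[of h g] coords_SU2[OF h] coords_frame[OF h] g y c by simp
  with h coords_uminus[OF h] that show thesis by metis
qed

lemma SU2_coords:
  assumes "g \<in> SU2"
  obtains a b c where "coords g a b c"
  using coords_with_base[OF assms] sph_exists[OF frame_SU2(1)[OF assms]] by metis

section \<open>Contact elements and the fibres of the quotient map\<close>

lemma outer_uminus [simp]: "outer (- v) = outer v"
  by (simp add: outer_def)

text \<open>One index with a nonzero entry fixes the sign; the products with that entry transfer it
  to all the others.\<close>

lemma outer_eq_iff: "outer v = outer w \<longleftrightarrow> v = w \<or> v = - w"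
proof
  assume "outer v = outer w"
  then have eq: "v $ i * v $ j = w $ i * w $ j" for i j
    by (simp add: outer_def vec_eq_iff)
  show "v = w \<or> v = - w"
  proof (cases "w = 0")
    case True
    then have "v $ i = 0" for i using eq[of i i] by simp
    with True show ?thesis by (simp add: vec_eq_iff)
  next
    case False
    then obtain i where i: "w $ i \<noteq> 0" by (auto simp: vec_eq_iff)
    have "v $ i = w $ i \<or> v $ i = - w $ i" using eq[of i i] by (simp add: square_eq_iff)
    then show ?thesis
    proof
      assume "v $ i = w $ i"
      then have "v $ j = w $ j" for j using eq[of i j] i by simp
      then show ?thesis by (simp add: vec_eq_iff)
    next
      assume "v $ i = - w $ i"
      then have "w $ i * (v $ j + w $ j) = 0" for j using eq[of i j] by (simp add: algebra_simps)
      then show ?thesis using i by (simp add: vec_eq_iff eq_neg_iff_add_eq_0)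
    qed
  qed
qed auto

definition contact_elt :: "cmat \<Rightarrow> pts" where
  "contact_elt g = (base g, outer (dir g))"

lemma coords_contact_elt:
  assumes "coords g a b c"
  shows "contact_elt g = pts_pt a b (- c)"
  using coords_frame[OF assms] by (simp add: contact_elt_def pts_pt_def)

lemma frame_orthonormal:
  "e_a a b \<bullet> e_a a b = 1" "e_b a b \<bullet> e_b a b = 1" "e_a a b \<bullet> e_b a b = 0" "e_b a b \<bullet> e_a a b = 0"
proof -
  have 1: "(sin a)\<^sup>2 + (cos a)\<^sup>2 = 1" "(sin b)\<^sup>2 + (cos b)\<^sup>2 = 1" by simp_all
  show "e_a a b \<bullet> e_a a b = 1" "e_b a b \<bullet> e_b a b = 1" "e_a a b \<bullet> e_b a b = 0" "e_b a b \<bullet> e_a a b = 0"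
    unfolding inner_vec3 e_a_def e_b_def vector_3 using 1 by algebra+
qed

text \<open>Adding \<open>pi\<close> to \<open>c\<close> reverses the direction, which
  \<open>outer\<close> ignores. Equal directions give the even multiples of \<open>pi\<close> and
  opposite ones the odd multiples.\<close>

lemma contact_elt_eq_iff_coords:
  assumes g: "coords g a b c1" and h: "coords h a b c2"
  shows "contact_elt g = contact_elt h \<longleftrightarrow> (\<exists>k. c1 - c2 = of_int k * pi)"
proof -
  let ?d = "\<lambda>c. cos c *\<^sub>R e_a a b - sin c *\<^sub>R e_b a b"
  have d: "?d c = ?d c' \<longleftrightarrow> cos c = cos c' \<and> sin c = sin c'" for c c'
  proof
    assume "?d c = ?d c'"
    then have "?d c \<bullet> e_a a b = ?d c' \<bullet> e_a a b" "?d c \<bullet> e_b a b = ?d c' \<bullet> e_b a b" by simp_all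
    then show "cos c = cos c' \<and> sin c = sin c'"
      by (simp add: inner_diff_left frame_orthonormal)
  qed simp
  have "contact_elt g = contact_elt h \<longleftrightarrow> ?d c1 = ?d c2 \<or> ?d c1 = ?d (c2 + pi)"
    using coords_frame[OF g] coords_frame[OF h] by (simp add: contact_elt_def outer_eq_iff)
  also have "\<dots> \<longleftrightarrow> (\<exists>n::int. c1 = c2 + 2 * pi * n) \<or> (\<exists>n::int. c1 = c2 + pi + 2 * pi * n)"
    unfolding d by (metis sin_cos_eq_iff)
  also have "\<dots> \<longleftrightarrow> (\<exists>k. c1 - c2 = of_int k * pi)"
  proof
    assume "(\<exists>n::int. c1 = c2 + 2 * pi * n) \<or> (\<exists>n::int. c1 = c2 + pi + 2 * pi * n)"
    then obtain n :: int where "c1 - c2 = of_int (2 * n) * pi \<or> c1 - c2 = of_int (2 * n + 1) * pi"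
      by (auto simp: algebra_simps)
    then show "\<exists>k. c1 - c2 = of_int k * pi" by blast
  next
    assume "\<exists>k. c1 - c2 = of_int k * pi"
    then obtain k where k: "c1 = c2 + of_int k * pi" by (auto simp: algebra_simps)
    show "(\<exists>n::int. c1 = c2 + 2 * pi * n) \<or> (\<exists>n::int. c1 = c2 + pi + 2 * pi * n)"
      by (cases "even k") (auto simp: k algebra_simps elim!: evenE oddE)
  qed
  finally show ?thesis .
qed

text \<open>Exhibits \<open>approx\<close> on SU(2) as the kernel of a map, hence as an equivalence;
  transitivity is not evident from its existential definition, as coordinates at the poles are not
  unique.\<close>

lemma approx_iff:
  assumes g: "g \<in> SU2" and h: "h \<in> SU2"
  shows "approx g h \<longleftrightarrow> contact_elt g = contact_elt h"
proof
  assume "approx g h"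
  then show "contact_elt g = contact_elt h"
    unfolding approx_def using contact_elt_eq_iff_coords by blast
next
  assume eq: "contact_elt g = contact_elt h"
  obtain a b c1 where gc: "coords g a b c1" using SU2_coords[OF g] .
  then have "base h = sph a b" using eq coords_frame by (auto simp: contact_elt_def)
  with coords_with_base[OF h] gc obtain c2 where hc: "coords h a b c2" by (metis coords_iff)
  show "approx g h"
    unfolding approx_def using gc hc eq contact_elt_eq_iff_coords[OF gc hc] by blast
qed

lemma PiL_eq: "g \<in> SU2 \<Longrightarrow> PiL g = {h \<in> SU2. contact_elt h = contact_elt g}"
  by (auto simp: PiL_def approx_iff)

text \<open>The choice in \<open>PhiL\<close> ranges over all members of the class and all their
  coordinates, yet every candidate equals the same contact element.\<close>

lemma PhiL_PiL: "g \<in> SU2 \<Longrightarrow> PhiL (PiL g) = contact_elt g"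
proof -
  assume g: "g \<in> SU2"
  let ?P = "\<lambda>p. \<exists>h\<in>PiL g. \<exists>a b c. coords h a b c \<and> p = pts_pt a b (- c)"
  obtain a b c where "coords g a b c" using SU2_coords[OF g] .
  then have "?P (contact_elt g)"
    using g coords_contact_elt[of g a b c] by (intro bexI[of _ g] exI) (auto simp: PiL_eq)
  moreover have "p = contact_elt g" if "?P p" for p
    using that g coords_contact_elt by (auto simp: PiL_eq)
  ultimately show ?thesis
    unfolding PhiL_def by (rule some_equality)
qed

lemma contact_elt_image: "contact_elt ` SU2 = PTS2"
proof (intro equalityI subsetI)
  fix x assume "x \<in> PTS2"
  then obtain y v where "x = (y, outer v)" "norm y = 1" "norm v = 1" "y \<bullet> v = 0"
    by (auto simp: PTS2_def)
  then show "x \<in> contact_elt ` SU2"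
    using frame_exists[of y v] by (metis contact_elt_def image_eqI)
qed (auto simp: contact_elt_def PTS2_def intro: frame_SU2)

lemma bij_PhiL: "bij_betw PhiL L41 PTS2"
  unfolding bij_betw_def
proof
  show "inj_on PhiL L41"
    by (auto simp: inj_on_def L41_def PhiL_PiL) (simp_all add: PiL_eq)
  show "PhiL ` L41 = PTS2"
    by (auto simp: L41_def image_image PhiL_PiL contact_elt_image[symmetric])
qed

section \<open>Smoothness and local sections\<close>

lemma Ck_on_continuous: "Ck_on n U f \<Longrightarrow> continuous_on U f"
proof (induction n)
  case (Suc n)
  then obtain f' where "\<forall>x\<in>U. (f has_derivative f' x) (at x)" by auto
  then show ?case
    by (auto intro!: continuous_at_imp_continuous_on dest: has_derivative_continuous)
qed simp

lemma Ck_on_Suc_D: "Ck_on (Suc n) U f \<Longrightarrow> Ck_on n U f"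
proof (induction n arbitrary: f)
  case 0
  then show ?case using Ck_on_continuous[OF 0] by simp
next
  case (Suc n)
  then obtain f' where "\<forall>x\<in>U. (f has_derivative f' x) (at x)" "\<forall>v. Ck_on (Suc n) U (\<lambda>x. f' x v)"
    by auto
  with Suc.IH show ?case by auto
qed

lemma Ck_on_subset: "Ck_on n U f \<Longrightarrow> V \<subseteq> U \<Longrightarrow> Ck_on n V f"
proof (induction n arbitrary: f)
  case (Suc n)
  then show ?case by simp (meson subsetD)
qed (auto intro: continuous_on_subset)

lemma Ck_on_const: "Ck_on n U (\<lambda>x. c)"
  by (induction n arbitrary: c) (auto intro!: exI[of _ "\<lambda>x v. 0"])

lemma Ck_on_bounded_linear: "bounded_linear L \<Longrightarrow> Ck_on n U L"
proof (cases n)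
  case (Suc m)
  assume "bounded_linear L"
  then show ?thesis
    by (auto simp: Suc intro!: exI[of _ "\<lambda>x. L"] Ck_on_const bounded_linear_imp_has_derivative)
qed (simp add: linear_continuous_on)

lemma Ck_on_add: "Ck_on n U f1 \<Longrightarrow> Ck_on n U f2 \<Longrightarrow> Ck_on n U (\<lambda>x. f1 x + f2 x)"
proof (induction n arbitrary: f1 f2)
  case (Suc n)
  then obtain f1' f2' where
    "\<forall>x\<in>U. (f1 has_derivative f1' x) (at x)" "\<forall>v. Ck_on n U (\<lambda>x. f1' x v)"
    "\<forall>x\<in>U. (f2 has_derivative f2' x) (at x)" "\<forall>v. Ck_on n U (\<lambda>x. f2' x v)"
    by auto
  with Suc.IH show ?case
    by (auto intro!: exI[of _ "\<lambda>x v. f1' x v + f2' x v"] has_derivative_add)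
qed (auto intro: continuous_on_add)

text \<open>The derivative pairs each function with the derivative of the other, so the induction
  also needs the functions themselves in the lower class, which \<open>Ck_on_Suc_D\<close>
  supplies.\<close>

lemma Ck_on_bilinear:
  assumes h: "bounded_bilinear h"
  shows "Ck_on n U f \<Longrightarrow> Ck_on n U g \<Longrightarrow> Ck_on n U (\<lambda>x. h (f x) (g x))"
proof (induction n arbitrary: f g)
  case 0
  then show ?case by (simp add: bounded_bilinear.continuous_on[OF h])
next
  case (Suc n)
  note Ck_on_Suc_D[OF Suc.prems(1)] Ck_on_Suc_D[OF Suc.prems(2)]
  moreover obtain f' g' where
    "\<forall>x\<in>U. (f has_derivative f' x) (at x)" "\<forall>v. Ck_on n U (\<lambda>x. f' x v)"
    "\<forall>x\<in>U. (g has_derivative g' x) (at x)" "\<forall>v. Ck_on n U (\<lambda>x. g' x v)"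
    using Suc.prems by auto
  ultimately show ?case
    using Suc.IH
    by (auto intro!: exI[of _ "\<lambda>x v. h (f x) (g' x v) + h (f' x v) (g x)"] Ck_on_add
        bounded_bilinear.FDERIV[OF h])
qed

lemma Ck_on_linear_compose:
  assumes L: "bounded_linear L"
  shows "Ck_on n U f \<Longrightarrow> Ck_on n U (\<lambda>x. L (f x))"
proof (induction n arbitrary: f)
  case (Suc n)
  then obtain f' where
    "\<forall>x\<in>U. (f has_derivative f' x) (at x)" "\<forall>v. Ck_on n U (\<lambda>x. f' x v)"
    by auto
  with Suc.IH show ?case
    by (auto intro!: exI[of _ "\<lambda>x v. L (f' x v)"] bounded_linear.has_derivative[OF L])
qed (simp add: bounded_linear.continuous_on[OF L])

lemmas Ck_on_mult = Ck_on_bilinear[OF bounded_bilinear_mult]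

lemma Ck_on_minus: "Ck_on n U f \<Longrightarrow> Ck_on n U (\<lambda>x. - f x)"
  by (rule Ck_on_linear_compose[OF bounded_linear_minus[OF bounded_linear_ident]])

lemma Ck_on_diff: "Ck_on n U f \<Longrightarrow> Ck_on n U g \<Longrightarrow> Ck_on n U (\<lambda>x. f x - g x)"
  using Ck_on_add[of n U f "\<lambda>x. - g x"] by (simp add: Ck_on_minus)

lemma Ck_on_sum:
  assumes "\<And>i. i \<in> I \<Longrightarrow> Ck_on n U (f i)"
  shows "Ck_on n U (\<lambda>x. \<Sum>i\<in>I. f i x)"
  using assms by (induction I rule: infinite_finite_induct) (auto intro!: Ck_on_add Ck_on_const)

text \<open>Serves the normalisations in the local sections, whose other ingredients are polynomial.
  The exponent varies in the induction because differentiation lowers it by one.\<close>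

lemma Ck_on_powr:
  fixes f :: "'a::real_normed_vector \<Rightarrow> real"
  assumes pos: "\<And>x. x \<in> U \<Longrightarrow> 0 < f x"
  shows "Ck_on n U f \<Longrightarrow> Ck_on n U (\<lambda>x. f x powr a)"
proof (induction n arbitrary: a)
  case 0
  then show ?case using pos by (fastforce intro!: continuous_on_powr continuous_on_const)
next
  case (Suc n)
  then obtain f' where
    f': "\<forall>x\<in>U. (f has_derivative f' x) (at x)" "\<forall>v. Ck_on n U (\<lambda>x. f' x v)"
    by auto
  have "((\<lambda>x. f x powr a) has_derivative (\<lambda>v. a * f x powr (a - 1) * f' x v)) (at x)" if x: "x \<in> U" for x
  proof -
    have "((\<lambda>z. z powr a) has_derivative (\<lambda>z. (a * f x powr (a - 1)) * z)) (at (f x))"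
      using has_real_derivative_powr[OF pos[OF x], of a] by (simp add: has_field_derivative_def)
    from has_derivative_compose[OF f'(1)[rule_format, OF x] this] show ?thesis .
  qed
  moreover have "Ck_on n U (\<lambda>x. a * f x powr (a - 1) * f' x v)" for v
    using Suc.IH[OF Ck_on_Suc_D[OF Suc.prems], of "a - 1"] f'(2)
    by (auto intro!: Ck_on_mult Ck_on_const)
  ultimately show ?case
    by (auto intro!: exI[of _ "\<lambda>x v. a * f x powr (a - 1) * f' x v"])
qed

lemma Ck_on_componentwise:
  fixes f :: "'a::real_normed_vector \<Rightarrow> 'b::euclidean_space"
  assumes "\<And>b. b \<in> Basis \<Longrightarrow> Ck_on n U (\<lambda>x. f x \<bullet> b)"
  shows "Ck_on n U f"
proof -
  have "Ck_on n U (\<lambda>x. \<Sum>b\<in>Basis. (f x \<bullet> b) *\<^sub>R b)"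
    by (intro Ck_on_sum Ck_on_linear_compose[OF bounded_linear_scaleR_left] assms)
  then show ?thesis by (simp add: euclidean_representation)
qed

lemma Ck_on_Pair:
  fixes f :: "'a::real_normed_vector \<Rightarrow> 'b::euclidean_space" and g :: "'a \<Rightarrow> 'c::euclidean_space"
  assumes "Ck_on n U f" "Ck_on n U g"
  shows "Ck_on n U (\<lambda>x. (f x, g x))"
proof (rule Ck_on_componentwise)
  fix b :: "'b \<times> 'c" assume "b \<in> Basis"
  then show "Ck_on n U (\<lambda>x. (f x, g x) \<bullet> b)"
    using Ck_on_linear_compose[OF bounded_linear_inner_left assms(1)]
      Ck_on_linear_compose[OF bounded_linear_inner_left assms(2)]
    by (auto simp: Basis_prod_def)
qed

lemma Ck_on_vec:
  fixes f :: "'a::real_normed_vector \<Rightarrow> 'b::euclidean_space ^ 'n"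
  assumes "\<And>i. Ck_on n U (\<lambda>x. f x $ i)"
  shows "Ck_on n U f"
proof (rule Ck_on_componentwise)
  fix b :: "'b ^ 'n" assume "b \<in> Basis"
  then show "Ck_on n U (\<lambda>x. f x \<bullet> b)"
    using Ck_on_linear_compose[OF bounded_linear_inner_left assms]
    by (auto simp: Basis_vec_def inner_axis)
qed

lemma Ck_on_Complex:
  assumes "Ck_on n U f" "Ck_on n U g"
  shows "Ck_on n U (\<lambda>x. Complex (f x) (g x))"
  by (rule Ck_on_componentwise) (use assms in \<open>auto simp: Basis_complex_def inner_complex_def\<close>)

lemma Ck_on_outer: "Ck_on n U v \<Longrightarrow> Ck_on n U (\<lambda>x. outer (v x))"
  by (intro Ck_on_vec)
    (auto simp: outer_def intro!: Ck_on_mult Ck_on_linear_compose[OF bounded_linear_vec_nth])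

lemma Ck_on_vec3:
  fixes f :: "'a::real_normed_vector \<Rightarrow> real ^ 3"
  assumes "Ck_on n U (\<lambda>x. f x $ 1)" "Ck_on n U (\<lambda>x. f x $ 2)" "Ck_on n U (\<lambda>x. f x $ 3)"
  shows "Ck_on n U f"
proof (rule Ck_on_vec)
  fix i :: 3 show "Ck_on n U (\<lambda>x. f x $ i)"
    using assms exhaust_3[of i] by auto
qed

lemmas Ck_on_intros = Ck_on_const Ck_on_add Ck_on_diff Ck_on_minus Ck_on_mult

lemma Ck_on_quat:
  assumes "Ck_on n U p" "Ck_on n U q" "Ck_on n U r" "Ck_on n U s"
  shows "Ck_on n U (\<lambda>x. quat (p x) (q x) (r x) (s x))"
proof (intro Ck_on_vec)
  fix i j :: 2
  show "Ck_on n U (\<lambda>x. quat (p x) (q x) (r x) (s x) $ i $ j)"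
    using assms exhaust_2[of i] exhaust_2[of j]
    by (auto simp: quat_def intro!: Ck_on_Complex Ck_on_minus)
qed

text \<open>All entries are polynomials in the real and imaginary parts of \<open>g\<close>, so the
  formula is smooth on every matrix and SU(2) may be enlarged to \<open>UNIV\<close>.\<close>

lemma smooth_contact_elt: "smooth_on UNIV contact_elt"
proof -
  have c: "Ck_on n UNIV (\<lambda>g :: cmat. Re (g $ i $ j))" "Ck_on n UNIV (\<lambda>g :: cmat. Im (g $ i $ j))" for n i j
    by (intro Ck_on_bounded_linear bounded_linear_intros
        bounded_linear_compose[OF bounded_linear_Re] bounded_linear_compose[OF bounded_linear_Im]
        bounded_linear_compose[OF bounded_linear_vec_nth bounded_linear_vec_nth])+
  show ?thesis
    unfolding smooth_on_def contact_elt_def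
    by (auto intro!: Ck_on_Pair Ck_on_outer Ck_on_vec3 Ck_on_intros c
        simp: base_def dir_def Let_def)
qed

text \<open>On unit quaternions \<open>\<xi>\<close> the entries of \<open>4 \<xi> \<xi>\<^sup>T\<close> are affine in the frame
  (lemma \<open>quat_products\<close>); applying this matrix to a fixed quaternion \<open>\<xi>0\<close> gives
  \<open>4 (\<xi> \<bullet> \<xi>0) \<xi>\<close>, so normalising recovers \<open>\<xi>\<close> up to sign wherever \<open>\<xi> \<bullet> \<xi>0 \<noteq> 0\<close>.
  The same device recovers a unit vector \<open>v\<close> from \<open>outer v\<close>.\<close>
lemma local_section:
  assumes p: "p \<in> PTS2"
  shows "\<exists>V G. p \<in> V \<and> smooth_on V (G :: pts \<Rightarrow> cmat) \<and>
          (\<forall>x\<in>PTS2 \<inter> V. G x \<in> SU2 \<and> contact_elt (G x) = x)"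
proof -
  obtain g0 where g0: "g0 \<in> SU2" and p_eq: "p = contact_elt g0"
    using p contact_elt_image by blast
  obtain a b c d where g0_eq: "g0 = quat a b c d" and n0: "a\<^sup>2 + b\<^sup>2 + c\<^sup>2 + d\<^sup>2 = 1"
    using g0 by (auto simp: SU2_iff)
  define v0 where "v0 = dir g0"
  have v0: "v0 \<bullet> v0 = 1" using frame_SU2(2)[OF g0] by (simp add: v0_def norm_eq_1)
  \<comment> \<open>The quadratic form of the matrix component at \<open>v0\<close>; on
    \<open>outer u\<close> it equals the square of the inner product of \<open>u\<close> and
    \<open>v0\<close>, so positivity says that these are not orthogonal.\<close>
  define k :: "pts \<Rightarrow> real" where "k x = (\<Sum>i\<in>UNIV. \<Sum>j\<in>UNIV. v0 $ i * (snd x $ i $ j * v0 $ j))" for x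
  define v where "v i x = (\<Sum>j\<in>UNIV. snd x $ i $ j * v0 $ j) * k x powr (-1/2)" for i and x :: pts
  define y where "y i x = fst x $ i" for i and x :: pts
  define w1 where "w1 x = y 2 x * v 3 x - y 3 x * v 2 x" for x
  define w2 where "w2 x = y 3 x * v 1 x - y 1 x * v 3 x" for x
  define w3 where "w3 x = y 1 x * v 2 x - y 2 x * v 1 x" for x
  define A where "A x = (1 + y 3 x + v 1 x + w2 x) * a + (w1 x - v 2 x) * b + (y 1 x - v 3 x) * c + (y 2 x - w3 x) * d" for x
  define B where "B x = (w1 x - v 2 x) * a + (1 + y 3 x - v 1 x - w2 x) * b + (- y 2 x - w3 x) * c + (y 1 x + v 3 x) * d" for x
  define C where "C x = (y 1 x - v 3 x) * a + (- y 2 x - w3 x) * b + (1 - y 3 x - v 1 x + w2 x) * c + (- w1 x - v 2 x) * d" for x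
  define D where "D x = (y 2 x - w3 x) * a + (y 1 x + v 3 x) * b + (- w1 x - v 2 x) * c + (1 - y 3 x + v 1 x - w2 x) * d" for x
  define m where "m x = A x * a + B x * b + C x * c + D x * d" for x
  \<comment> \<open>With \<open>t\<close> the inner product of the sought quaternion and
    \<open>(a, b, c, d)\<close>, the vector \<open>(A, B, C, D)\<close> has length
    \<open>4 * \<bar>t\<bar>\<close> while \<open>m\<close> is \<open>4 * t\<close> times
    \<open>t\<close>. The factor 1/2 turns the inverse root of \<open>m\<close> into
    \<open>1 / (4 * \<bar>t\<bar>)\<close>.\<close>
  define e where "e x = m x powr (-1/2) * (1/2)" for x
  define G where "G x = quat (A x * e x) (B x * e x) (C x * e x) (D x * e x)" for x
  define V1 where "V1 = {x. 0 < k x}"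
  define V where "V = V1 \<inter> m -` {0<..}"
  have smy: "Ck_on n U (\<lambda>x. y i x)" for n U i
    unfolding y_def
    by (intro Ck_on_bounded_linear bounded_linear_compose[OF bounded_linear_vec_nth bounded_linear_fst])
  have sm0: "Ck_on n U (\<lambda>x::pts. snd x $ i $ j)" for n U i j
    by (intro Ck_on_bounded_linear bounded_linear_compose[OF bounded_linear_vec_nth]
         bounded_linear_compose[OF bounded_linear_vec_nth bounded_linear_snd])
  have smk: "Ck_on n U k" for n U
    unfolding k_def by (intro Ck_on_sum Ck_on_intros sm0)
  have smv: "Ck_on n V1 (v i)" for n i
    unfolding v_def by (intro Ck_on_sum Ck_on_intros sm0 Ck_on_powr smk) (auto simp: V1_def)
  have smA: "Ck_on n V1 A" "Ck_on n V1 B" "Ck_on n V1 C" "Ck_on n V1 D" for n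
    unfolding A_def B_def C_def D_def w1_def w2_def w3_def by (intro Ck_on_intros smy smv)+
  have smm: "Ck_on n V1 m" for n
    unfolding m_def by (intro Ck_on_intros smA)
  have "open V1"
    unfolding V1_def using Ck_on_continuous[OF smk[of 0 UNIV]]
    by (intro open_Collect_less continuous_on_const)
  then have "open V"
    unfolding V_def using Ck_on_continuous[OF smm[of 0]]
    by (auto intro!: continuous_open_preimage)
  have VV: "V \<subseteq> V1" by (auto simp: V_def)
  have "Ck_on n V e" for n
    unfolding e_def by (intro Ck_on_intros Ck_on_powr Ck_on_subset[OF smm VV]) (auto simp: V_def)
  then have smG: "smooth_on V G"
    unfolding smooth_on_def G_def
    using \<open>open V\<close> by (auto intro!: Ck_on_quat Ck_on_mult Ck_on_subset[OF smA(1) VV]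
       Ck_on_subset[OF smA(2) VV] Ck_on_subset[OF smA(3) VV] Ck_on_subset[OF smA(4) VV])
  have key: "k (contact_elt h) = (dir h \<bullet> v0)\<^sup>2" if h: "h \<in> SU2" for h
    by (simp add: k_def contact_elt_def outer_def inner_vec3 sum_3 power2_eq_square algebra_simps)
  have vval: "(\<chi> i. v i (contact_elt h)) = sgn (dir h \<bullet> v0) *\<^sub>R dir h" if "dir h \<bullet> v0 \<noteq> 0" "h \<in> SU2" for h
  proof -
    have "k (contact_elt h) powr (-1/2) = 1 / \<bar>dir h \<bullet> v0\<bar>"
      unfolding key[OF that(2)] using that(1)
      by (simp add: powr_minus_divide powr_half_sqrt)
    moreover have "(\<Sum>j\<in>UNIV. snd (contact_elt h) $ i $ j * v0 $ j) = dir h $ i * (dir h \<bullet> v0)" for i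
      by (simp add: contact_elt_def outer_def inner_vec3 sum_3 algebra_simps)
    ultimately show ?thesis
      by (simp add: v_def vec_eq_iff sgn_real_def)
  qed
  have val: "\<exists>p q r s. p\<^sup>2 + q\<^sup>2 + r\<^sup>2 + s\<^sup>2 = 1 \<and> contact_elt (quat p q r s) = x \<and>
      A x = 4 * (a * p + b * q + c * r + d * s) * p \<and> B x = 4 * (a * p + b * q + c * r + d * s) * q \<and>
      C x = 4 * (a * p + b * q + c * r + d * s) * r \<and> D x = 4 * (a * p + b * q + c * r + d * s) * s"
    if x: "x \<in> PTS2" "x \<in> V1" for x
  proof -
    obtain h where h: "h \<in> SU2" "x = contact_elt h" using x(1) contact_elt_image by blast
    have nz: "dir h \<bullet> v0 \<noteq> 0" using x(2) key[OF h(1)] by (auto simp: V1_def h(2))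
    \<comment> \<open>\<open>v\<close> returns \<open>dir h\<close> with the sign that makes its
      inner product with \<open>v0\<close> positive. The quaternion matching \<open>A\<close> to
      \<open>D\<close> must have this direction, so \<open>h\<close> is replaced by an
      \<open>f\<close> over the same point.\<close>
    define u where "u = sgn (dir h \<bullet> v0) *\<^sub>R dir h"
    have u: "norm u = 1" "outer u = outer (dir h)" "base h \<bullet> u = 0"
      using nz frame_SU2[OF h(1)] by (auto simp: u_def sgn_real_def)
    obtain f where f: "f \<in> SU2" "base f = base h" "dir f = u"
      using frame_exists[OF frame_SU2(1)[OF h(1)] u(1,3)] .
    obtain p q r s where f_eq: "f = quat p q r s" and n: "p\<^sup>2 + q\<^sup>2 + r\<^sup>2 + s\<^sup>2 = 1"
      using f(1) by (auto simp: SU2_iff)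
    have fx: "contact_elt f = x" using f u h by (simp add: contact_elt_def)
    have yx: "y i x = base f $ i" for i using f h by (simp add: y_def contact_elt_def)
    have vx: "v i x = dir f $ i" for i
      using vval[OF nz h(1)] f(3) by (simp add: u_def h(2) vec_eq_iff)
    note Q = quat_products[OF n, folded f_eq, unfolded cross3_nth, symmetric]
    have "A x = 4 * (a * p + b * q + c * r + d * s) * p \<and> B x = 4 * (a * p + b * q + c * r + d * s) * q \<and>
      C x = 4 * (a * p + b * q + c * r + d * s) * r \<and> D x = 4 * (a * p + b * q + c * r + d * s) * s"
      unfolding A_def B_def C_def D_def w1_def w2_def w3_def yx vx Q
      by (simp add: algebra_simps)
    with n fx show ?thesis unfolding f_eq by blast
  qed
  have mval: "m x = 4 * (a * p + b * q + c * r + d * s)\<^sup>2"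
    if "A x = 4 * (a * p + b * q + c * r + d * s) * p" "B x = 4 * (a * p + b * q + c * r + d * s) * q"
      "C x = 4 * (a * p + b * q + c * r + d * s) * r" "D x = 4 * (a * p + b * q + c * r + d * s) * s" for x p q r s
    unfolding m_def that by algebra
  have good: "G x \<in> SU2 \<and> contact_elt (G x) = x" if x: "x \<in> PTS2 \<inter> V" for x
  proof -
    from x VV obtain p q r s where n: "p\<^sup>2 + q\<^sup>2 + r\<^sup>2 + s\<^sup>2 = 1" and cx: "contact_elt (quat p q r s) = x" and
      ABCD: "A x = 4 * (a * p + b * q + c * r + d * s) * p" "B x = 4 * (a * p + b * q + c * r + d * s) * q"
      "C x = 4 * (a * p + b * q + c * r + d * s) * r" "D x = 4 * (a * p + b * q + c * r + d * s) * s"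
      using val[of x] by blast
    define t where "t = a * p + b * q + c * r + d * s"
    have m: "m x = (2 * t)\<^sup>2" unfolding mval[OF ABCD] by (simp add: t_def[symmetric])
    have t: "t \<noteq> 0" using x m by (auto simp: V_def)
    have "e x = 1 / (4 * \<bar>t\<bar>)"
      unfolding e_def m using t by (simp add: powr_minus_divide powr_half_sqrt real_sqrt_mult)
    then have "A x * e x = sgn t * p" "B x * e x = sgn t * q" "C x * e x = sgn t * r" "D x * e x = sgn t * s"
      using t unfolding ABCD t_def[symmetric] by (auto simp: sgn_real_def)
    then have "G x = quat p q r s \<or> G x = - quat p q r s"
      using t by (auto simp: G_def quat_uminus sgn_real_def)
    moreover have "contact_elt (- quat p q r s) = contact_elt (quat p q r s)"
      by (simp add: contact_elt_def quat_uminus base_quat dir_quat)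
    moreover have "quat p q r s \<in> SU2" "- quat p q r s \<in> SU2"
      using n by (auto simp: quat_uminus intro: quat_SU2)
    ultimately show ?thesis using cx by auto
  qed
  have "p \<in> V"
  proof -
    have kp: "k p = 1" using key[OF g0] v0 by (simp add: p_eq v0_def)
    then have pV1: "p \<in> V1" by (simp add: V1_def)
    have vp: "v i p = dir g0 $ i" for i
    proof -
      have 1: "dir g0 \<bullet> v0 = 1" using v0 by (simp add: v0_def)
      have "(\<chi> i. v i (contact_elt g0)) = sgn (dir g0 \<bullet> v0) *\<^sub>R dir g0"
        by (rule vval) (simp_all add: 1 g0)
      then show ?thesis by (simp add: 1 p_eq vec_eq_iff)
    qed
    have yp: "y i p = base g0 $ i" for i by (simp add: y_def contact_elt_def p_eq)
    note Q = quat_products[OF n0, folded g0_eq, unfolded cross3_nth, symmetric]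
    have "A p = 4 * (a * a + b * b + c * c + d * d) * a" "B p = 4 * (a * a + b * b + c * c + d * d) * b"
      "C p = 4 * (a * a + b * b + c * c + d * d) * c" "D p = 4 * (a * a + b * b + c * c + d * d) * d"
      unfolding A_def B_def C_def D_def w1_def w2_def w3_def yp vp Q
      by (simp_all add: algebra_simps)
    from mval[OF this] n0 have "m p = 4" by (simp add: power2_eq_square)
    with pV1 show ?thesis by (simp add: V_def)
  qed
  with smG good show ?thesis by blast
qed

section \<open>Horizontal curves\<close>

lemma bounded_linear_matrix_mult_right: "bounded_linear (\<lambda>g :: cmat. g ** (P :: cmat))"
  by (intro linear_conv_bounded_linear[THEN iffD1] linearI)
    (simp_all add: scaleR_matrix_mult cmat_eq_iff matrix_mult_nth2 algebra_simps)

lemma matrix_mult_control: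
  "(g :: cmat) ** (x *\<^sub>R p1 + y *\<^sub>R p2) = x *\<^sub>R (g ** p1) + y *\<^sub>R (g ** p2)"
  by (simp add: matrix_add_ldistrib matrix_mult_scaleR)

text \<open>Absolute integrability of the right-hand side is automatic: the integral equation makes
  \<open>g\<close> continuous, and the controls are absolutely integrable.\<close>

lemma hor_SU2_ctrl_iff:
  "hor_SU2_ctrl T g u1 u2 \<longleftrightarrow> (\<forall>t\<in>{0..T}. g t \<in> SU2) \<and>
     u1 absolutely_integrable_on {0..T} \<and> u2 absolutely_integrable_on {0..T} \<and>
     primitive_on T g (\<lambda>s. u1 s *\<^sub>R (g s ** p1) + u2 s *\<^sub>R (g s ** p2))"
proof -
  have "(\<lambda>s. u1 s *\<^sub>R (g s ** p1) + u2 s *\<^sub>R (g s ** p2)) absolutely_integrable_on {0..T}"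
    if u: "u1 absolutely_integrable_on {0..T}" "u2 absolutely_integrable_on {0..T}"
      and g: "\<forall>t\<in>{0..T}. ((\<lambda>s. u1 s *\<^sub>R (g s ** p1) + u2 s *\<^sub>R (g s ** p2)) has_integral (g t - g 0)) {0..t}"
  proof -
    have c: "continuous_on {0..T} (\<lambda>s. g s ** P)" for P :: cmat
      by (rule bounded_linear.continuous_on[OF bounded_linear_matrix_mult_right
            has_integral_imp_continuous_on]) (use g in blast)
    show ?thesis
      by (intro set_integral_add u c
          absolutely_integrable_bilinear[OF bounded_bilinear.flip[OF bounded_bilinear_scaleR]])
  qed
  then show ?thesis
    unfolding hor_SU2_ctrl_def matrix_mult_control primitive_on_def by blast
qed

lemma hor_PTS_ctrlI:
  assumes "u1 absolutely_integrable_on {0..T}" "u2 absolutely_integrable_on {0..T}"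
    and yv: "\<And>t. t \<in> {0..T} \<Longrightarrow> \<Gamma> t = (y t, outer (v t)) \<and> norm (y t) = 1 \<and> norm (v t) = 1 \<and> y t \<bullet> v t = 0"
    and y: "primitive_on T y (\<lambda>s. u1 s *\<^sub>R v s)"
    and v: "primitive_on T v (\<lambda>s. u2 s *\<^sub>R cross3 (y s) (v s) - u1 s *\<^sub>R y s)"
  shows "hor_PTS_ctrl T \<Gamma> u1 u2"
  unfolding hor_PTS_ctrl_def
proof (intro conjI)
  have "((\<lambda>s. u1 s *\<^sub>R v s) has_integral y t - y 0) {0..t}"
    "((\<lambda>s. u2 s *\<^sub>R cross3 (y s) (v s) - u1 s *\<^sub>R y s) has_integral v t - v 0) {0..t}"
    if "t \<in> {0..T}" for t
    using y v that unfolding primitive_on_def by blast+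
  with yv show "\<exists>y v. (\<forall>t\<in>{0..T}. \<Gamma> t = (y t, outer (v t)) \<and> norm (v t) = 1 \<and> y t \<bullet> v t = 0) \<and>
        (\<forall>t\<in>{0..T}. ((\<lambda>s. u1 s *\<^sub>R v s) has_integral (y t - y 0)) {0..t}) \<and>
        (\<forall>t\<in>{0..T}. ((\<lambda>s. u2 s *\<^sub>R cross3 (y s) (v s) - u1 s *\<^sub>R y s)
                         has_integral (v t - v 0)) {0..t})"
    by - (rule exI[of _ y], rule exI[of _ v], blast)
  show "\<forall>t\<in>{0..T}. \<Gamma> t \<in> PTS2"
    using yv unfolding PTS2_def by blast
qed (fact assms)+

text \<open>Adds what the definition leaves implicit: \<open>y\<close> has norm one because the
  curve lies in \<open>PTS2\<close>, and both right-hand sides are absolutely integrable because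
  \<open>y\<close> and \<open>v\<close> are continuous.\<close>

lemma hor_PTS_ctrlE:
  assumes "hor_PTS_ctrl T \<Gamma> u1 u2"
  obtains y v where "u1 absolutely_integrable_on {0..T}" "u2 absolutely_integrable_on {0..T}"
    "\<And>t. t \<in> {0..T} \<Longrightarrow> \<Gamma> t = (y t, outer (v t)) \<and> norm (y t) = 1 \<and> norm (v t) = 1 \<and> y t \<bullet> v t = 0"
    "primitive_on T y (\<lambda>s. u1 s *\<^sub>R v s)"
    "primitive_on T v (\<lambda>s. u2 s *\<^sub>R cross3 (y s) (v s) - u1 s *\<^sub>R y s)"
proof -
  obtain y v where \<Gamma>: "\<forall>t\<in>{0..T}. \<Gamma> t \<in> PTS2"
    and u: "u1 absolutely_integrable_on {0..T}" "u2 absolutely_integrable_on {0..T}"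
    and yv: "\<forall>t\<in>{0..T}. \<Gamma> t = (y t, outer (v t)) \<and> norm (v t) = 1 \<and> y t \<bullet> v t = 0"
    and y: "\<forall>t\<in>{0..T}. ((\<lambda>s. u1 s *\<^sub>R v s) has_integral (y t - y 0)) {0..t}"
    and v: "\<forall>t\<in>{0..T}. ((\<lambda>s. u2 s *\<^sub>R cross3 (y s) (v s) - u1 s *\<^sub>R y s)
                         has_integral (v t - v 0)) {0..t}"
    using assms unfolding hor_PTS_ctrl_def by (elim conjE exE)
  have cy: "continuous_on {0..T} y"
    by (rule has_integral_imp_continuous_on) (use y in blast)
  have cv: "continuous_on {0..T} v"
    by (rule has_integral_imp_continuous_on) (use v in blast)
  have cw: "continuous_on {0..T} (\<lambda>s. cross3 (y s) (v s))"
    by (rule continuous_on_cross[OF cy cv])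
  note flip = absolutely_integrable_bilinear[OF bounded_bilinear.flip[OF bounded_bilinear_scaleR]]
  show thesis
  proof (rule that)
    show "primitive_on T y (\<lambda>s. u1 s *\<^sub>R v s)"
      unfolding primitive_on_def using y flip[OF cv u(1)] by blast
    show "primitive_on T v (\<lambda>s. u2 s *\<^sub>R cross3 (y s) (v s) - u1 s *\<^sub>R y s)"
      unfolding primitive_on_def using v set_integral_diff(1)[OF flip[OF cw u(2)] flip[OF cy u(1)]] by blast
    fix t assume t: "t \<in> {0..T}"
    from \<Gamma> t have "\<Gamma> t \<in> PTS2" by blast
    then obtain y' v' where "\<Gamma> t = (y', outer v')" "norm y' = 1"
      unfolding PTS2_def by blast
    with yv t show "\<Gamma> t = (y t, outer (v t)) \<and> norm (y t) = 1 \<and> norm (v t) = 1 \<and> y t \<bullet> v t = 0"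
      by (metis prod.inject)
  qed (fact u)+
qed

lemma cross3_orthonormal:
  assumes "norm y = 1" "norm v = 1" "y \<bullet> v = 0"
  shows "norm (cross3 y v) = 1" "cross3 y (cross3 y v) = - v"
proof -
  have "(norm (cross3 y v))\<^sup>2 = 1"
    using norm_cross_dot[of y v] assms by simp
  then show "norm (cross3 y v) = 1"
    by (metis norm_ge_zero one_power2 power2_eq_iff_nonneg zero_le_one)
  have "y \<bullet> y = 1"
    using assms(1) norm_eq_1 by blast
  then show "cross3 y (cross3 y v) = - v"
    unfolding Lagrange assms(3) by simp
qed

lemma primitive_on_vec3:
  fixes f :: "real \<Rightarrow> real ^ 3"
  assumes "\<And>i. primitive_on T (\<lambda>t. f t $ i) (\<lambda>t. f' t $ i)"
  shows "primitive_on T f f'"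
  by (rule primitive_on_componentwise) (use assms in \<open>auto simp: Basis_vec_def inner_axis\<close>)

lemma primitive_on_cmult:
  fixes f :: "real \<Rightarrow> real"
  shows "primitive_on T f f' \<Longrightarrow> primitive_on T (\<lambda>t. c * f t) (\<lambda>t. c * f' t)"
  by (rule primitive_on_linear[OF bounded_linear_mult_right])

text \<open>Both \<open>g\<close> and the frame are driven by the same controls up to the sign of \<open>u2\<close>,
  since \<open>Ad g p1\<close> corresponds to \<open>- cross3 (base g) (dir g)\<close>.\<close>
lemma frame_primitive:
  assumes g: "primitive_on T g (\<lambda>s. u1 s *\<^sub>R (g s ** p1) + u2 s *\<^sub>R (g s ** p2))"
    and SU: "\<And>t. t \<in> {0..T} \<Longrightarrow> g t \<in> SU2"
  shows "primitive_on T (\<lambda>t. base (g t)) (\<lambda>s. u1 s *\<^sub>R dir (g s))"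
    and "primitive_on T (\<lambda>t. dir (g t)) (\<lambda>s. (- u2 s) *\<^sub>R cross3 (base (g s)) (dir (g s)) - u1 s *\<^sub>R base (g s))"
proof -
  define p q r s where "p t = Re (g t $ 1 $ 1)" and "q t = Im (g t $ 1 $ 2)"
    and "r t = Re (g t $ 1 $ 2)" and "s t = Im (g t $ 1 $ 1)" for t
  have L: "bounded_linear (\<lambda>g :: cmat. Re (g $ i $ j))" "bounded_linear (\<lambda>g :: cmat. Im (g $ i $ j))" for i j
    by (intro bounded_linear_compose[OF bounded_linear_Re] bounded_linear_compose[OF bounded_linear_Im]
        bounded_linear_compose[OF bounded_linear_vec_nth bounded_linear_vec_nth])+
  have p: "primitive_on T p (\<lambda>t. (1/2) * (- (r t * u1 t) - q t * u2 t))"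
    by (rule primitive_on_cong[OF primitive_on_linear[OF L(1)[of 1 1] g]])
      (simp_all add: p_def q_def r_def matrix_mult_nth2 p1_def p2_def field_simps)
  have q: "primitive_on T q (\<lambda>t. (1/2) * (p t * u2 t + s t * u1 t))"
    by (rule primitive_on_cong[OF primitive_on_linear[OF L(2)[of 1 2] g]])
      (simp_all add: p_def q_def s_def matrix_mult_nth2 p1_def p2_def field_simps)
  have r: "primitive_on T r (\<lambda>t. (1/2) * (p t * u1 t - s t * u2 t))"
    by (rule primitive_on_cong[OF primitive_on_linear[OF L(1)[of 1 2] g]])
      (simp_all add: p_def r_def s_def matrix_mult_nth2 p1_def p2_def field_simps)
  have s: "primitive_on T s (\<lambda>t. (1/2) * (r t * u2 t - q t * u1 t))"
    by (rule primitive_on_cong[OF primitive_on_linear[OF L(2)[of 1 1] g]])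
      (simp_all add: r_def q_def s_def matrix_mult_nth2 p1_def p2_def field_simps)
  note P = primitive_on_add primitive_on_diff primitive_on_mult primitive_on_cmult p q r s
  have b: "base (g t) = vector [2 * (r t * p t + s t * q t), 2 * (s t * p t - r t * q t), p t * p t + q t * q t - r t * r t - s t * s t]" for t
    by (simp add: base_def Let_def p_def q_def r_def s_def)
  have d: "dir (g t) = vector [p t * p t - q t * q t - r t * r t + s t * s t, - 2 * (p t * q t + r t * s t), 2 * (s t * q t - r t * p t)]" for t
    by (simp add: dir_def Let_def p_def q_def r_def s_def)
  have n: "p t * p t + q t * q t + r t * r t + s t * s t = 1" if "t \<in> {0..T}" for t
    using SU[OF that] by (auto simp: SU2_iff quat_def p_def q_def r_def s_def power2_eq_square)
  \<comment> \<open>The cross product has degree four; it is the norm square of the quaternion times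
    this quadratic vector, and \<open>n\<close> removes the norm.\<close>
  have w: "cross3 (base (g t)) (dir (g t)) = vector [2 * (p t * q t - r t * s t),
       p t * p t - q t * q t + r t * r t - s t * s t, - 2 * (p t * s t + q t * r t)]"
    if "t \<in> {0..T}" for t
    unfolding vec3_eq_iff cross3_nth b d vector_3 using n[OF that] by (intro conjI) algebra+
  show "primitive_on T (\<lambda>t. base (g t)) (\<lambda>s. u1 s *\<^sub>R dir (g s))"
  proof (rule primitive_on_vec3)
    fix i :: 3
    consider "i = 1" | "i = 2" | "i = 3" using exhaust_3 by blast
    then show "primitive_on T (\<lambda>t. base (g t) $ i) (\<lambda>s. (u1 s *\<^sub>R dir (g s)) $ i)"
    proof cases
      case 1
      have "primitive_on T (\<lambda>t. 2 * (r t * p t + s t * q t)) (\<lambda>t. u1 t * (p t * p t - q t * q t - r t * r t + s t * s t))"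
        by (rule primitive_on_cong, rule P(4)[OF P(1)[OF P(3)[OF r p] P(3)[OF s q]], where c = 2]) (auto simp: field_simps)
      then show ?thesis unfolding 1 b d vector_scaleR_component vector_3 by simp
    next
      case 2
      have "primitive_on T (\<lambda>t. 2 * (s t * p t - r t * q t)) (\<lambda>t. u1 t * (- 2 * (p t * q t + r t * s t)))"
        by (rule primitive_on_cong, rule P(4)[OF P(2)[OF P(3)[OF s p] P(3)[OF r q]], where c = 2]) (auto simp: field_simps)
      then show ?thesis unfolding 2 b d vector_scaleR_component vector_3 by simp
    next
      case 3
      have "primitive_on T (\<lambda>t. p t * p t + q t * q t - r t * r t - s t * s t) (\<lambda>t. u1 t * (2 * (s t * q t - r t * p t)))"
        by (rule primitive_on_cong, rule P(2)[OF P(2)[OF P(1)[OF P(3)[OF p p] P(3)[OF q q]] P(3)[OF r r]] P(3)[OF s s]]) (auto simp: field_simps)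
      then show ?thesis unfolding 3 b d vector_scaleR_component vector_3 by simp
    qed
  qed
  show "primitive_on T (\<lambda>t. dir (g t)) (\<lambda>s. (- u2 s) *\<^sub>R cross3 (base (g s)) (dir (g s)) - u1 s *\<^sub>R base (g s))"
  proof (rule primitive_on_vec3)
    fix i :: 3
    have red: "((- u2 t) *\<^sub>R cross3 (base (g t)) (dir (g t)) - u1 t *\<^sub>R base (g t)) $ i =
        - u2 t * (vector [2 * (p t * q t - r t * s t),
       p t * p t - q t * q t + r t * r t - s t * s t, - 2 * (p t * s t + q t * r t)] :: real^3) $ i - u1 t * base (g t) $ i"
      if "t \<in> {0..T}" for t
      unfolding w[OF that] by simp
    consider "i = 1" | "i = 2" | "i = 3" using exhaust_3 by blast
    then show "primitive_on T (\<lambda>t. dir (g t) $ i)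
       (\<lambda>s. ((- u2 s) *\<^sub>R cross3 (base (g s)) (dir (g s)) - u1 s *\<^sub>R base (g s)) $ i)"
    proof cases
      case 1
      show ?thesis
        by (rule primitive_on_cong, rule P(1)[OF P(2)[OF P(2)[OF P(3)[OF p p] P(3)[OF q q]] P(3)[OF r r]] P(3)[OF s s]])
          (simp_all only: red, simp_all add: b d 1 field_simps)
    next
      case 2
      show ?thesis
        by (rule primitive_on_cong, rule P(4)[OF P(1)[OF P(3)[OF p q] P(3)[OF r s]], where c = "- 2"])
          (simp_all only: red, simp_all add: b d 2 field_simps)
    next
      case 3
      show ?thesis
        by (rule primitive_on_cong, rule P(4)[OF P(2)[OF P(3)[OF s q] P(3)[OF r p]], where c = 2])
          (simp_all only: red, simp_all add: b d 3 field_simps)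
    qed
  qed
qed

lemma hor_PTS_ctrl_of_SU2:
  assumes "hor_SU2_ctrl T g u1 u2" "\<And>t. t \<in> {0..T} \<Longrightarrow> \<Gamma> t = contact_elt (g t)"
  shows "hor_PTS_ctrl T \<Gamma> u1 (\<lambda>s. - u2 s)"
proof -
  have g: "primitive_on T g (\<lambda>s. u1 s *\<^sub>R (g s ** p1) + u2 s *\<^sub>R (g s ** p2))"
    and SU: "\<And>t. t \<in> {0..T} \<Longrightarrow> g t \<in> SU2"
    and u: "u1 absolutely_integrable_on {0..T}" "u2 absolutely_integrable_on {0..T}"
    using assms(1) by (auto simp: hor_SU2_ctrl_iff)
  have "(\<lambda>s. - u2 s) absolutely_integrable_on {0..T}"
    using absolutely_integrable_linear[OF u(2) bounded_linear_minus[OF bounded_linear_ident]]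
    by (simp add: o_def)
  then show ?thesis
    using frame_primitive[OF g SU] assms(2) frame_SU2[OF SU]
    by (intro hor_PTS_ctrlI[OF u(1), where y = "\<lambda>t. base (g t)" and v = "\<lambda>t. dir (g t)"])
      (simp_all add: contact_elt_def)
qed

section \<open>Uniqueness of cost and length\<close>

lemma continuous_sign_constant:
  fixes f :: "real \<Rightarrow> real"
  assumes "continuous_on {0..T} f" "\<And>t. t \<in> {0..T} \<Longrightarrow> f t = 1 \<or> f t = - 1"
  obtains \<sigma> where "\<sigma> = 1 \<or> \<sigma> = - 1" "\<And>t. t \<in> {0..T} \<Longrightarrow> f t = \<sigma>"
proof -
  have "f t \<in> {1, - 1}" if "t \<in> {0..T}" for t
    using assms(2)[OF that] by simp
  then have "finite (f ` {0..T})"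
    by (meson finite.emptyI finite.insertI finite_subset image_subsetI)
  moreover have "connected (f ` {0..T})"
    by (rule connected_continuous_image[OF assms(1)]) simp
  ultimately have sing: "f ` {0..T} = {} \<or> (\<exists>x. f ` {0..T} = {x})"
    using connected_finite_iff_sing by blast
  show thesis
  proof (cases "0 \<le> T")
    case True
    then have 0: "0 \<in> {0..T}" by simp
    have "f t = f 0" if "t \<in> {0..T}" for t
      using sing imageI[OF 0, of f] imageI[OF that, of f] by (metis empty_iff singletonD)
    then show thesis using that assms(2)[OF 0] by blast
  next
    case False
    then have "{0..T} = {}" by simp
    then show thesis using that[of 1] by blast
  qed
qed

text \<open>The speed of the contact lift is the norm of \<open>v'\<close>, which depends on \<open>\<Gamma>\<close> only,
  as \<open>v\<close> is determined by \<open>\<Gamma>\<close> up to a global sign.\<close>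
lemma cost_unique:
  assumes "hor_PTS_ctrl T \<Gamma> u1 u2" "hor_PTS_ctrl T \<Gamma> w1 w2"
  shows "integral {0..T} (\<lambda>s. sqrt ((u1 s)\<^sup>2 + (u2 s)\<^sup>2)) = integral {0..T} (\<lambda>s. sqrt ((w1 s)\<^sup>2 + (w2 s)\<^sup>2))"
proof -
  obtain y v where yv: "\<And>t. t\<in>{0..T} \<Longrightarrow> \<Gamma> t = (y t, outer (v t)) \<and> norm (y t) = 1 \<and> norm (v t) = 1 \<and> y t \<bullet> v t = 0"
    and v: "primitive_on T v (\<lambda>s. u2 s *\<^sub>R cross3 (y s) (v s) - u1 s *\<^sub>R y s)"
    using assms(1) by (elim hor_PTS_ctrlE) blast
  obtain z x where zx: "\<And>t. t\<in>{0..T} \<Longrightarrow> \<Gamma> t = (z t, outer (x t)) \<and> norm (z t) = 1 \<and> norm (x t) = 1 \<and> z t \<bullet> x t = 0"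
    and x: "primitive_on T x (\<lambda>s. w2 s *\<^sub>R cross3 (z s) (x s) - w1 s *\<^sub>R z s)"
    using assms(2) by (elim hor_PTS_ctrlE) blast
  have eq: "x t = v t \<or> x t = - v t" if "t \<in> {0..T}" for t
    using yv[OF that] zx[OF that] by (auto simp: outer_eq_iff)
  have "continuous_on {0..T} (\<lambda>t. x t \<bullet> v t)"
    by (intro continuous_intros primitive_on_continuous[OF v] primitive_on_continuous[OF x])
  moreover have "x t \<bullet> v t = 1 \<or> x t \<bullet> v t = - 1" if "t \<in> {0..T}" for t
    using eq[OF that] yv[OF that] by (auto simp: norm_eq_1)
  ultimately obtain \<sigma> where \<sigma>: "\<sigma> = 1 \<or> \<sigma> = - 1" "\<And>t. t \<in> {0..T} \<Longrightarrow> x t \<bullet> v t = \<sigma>"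
    using continuous_sign_constant by blast
  have xv: "\<sigma> *\<^sub>R x t = v t" if "t \<in> {0..T}" for t
    using eq[OF that] \<sigma>(2)[OF that] yv[OF that] by (auto simp: norm_eq_1)
  \<comment> \<open>\<open>y\<close> and \<open>cross3 y v\<close> are orthonormal, so the two
    controls are orthogonal components of the velocity of \<open>v\<close>.\<close>
  have norm: "norm (b *\<^sub>R cross3 y v - a *\<^sub>R y) = sqrt (a\<^sup>2 + b\<^sup>2)"
    if "norm y = 1" "norm v = 1" "y \<bullet> v = 0" for a b y v
  proof -
    have "(b *\<^sub>R cross3 y v - a *\<^sub>R y) \<bullet> (b *\<^sub>R cross3 y v - a *\<^sub>R y) = a\<^sup>2 + b\<^sup>2"
      using that cross3_orthonormal(1)[OF that]
      by (simp add: inner_diff_left inner_diff_right dot_cross_self norm_eq_1 power2_eq_square)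
    then show ?thesis by (simp add: norm_eq_sqrt_inner)
  qed
  have "primitive_on T v (\<lambda>s. \<sigma> *\<^sub>R (w2 s *\<^sub>R cross3 (z s) (x s) - w1 s *\<^sub>R z s))"
    by (rule primitive_on_cong[OF primitive_on_linear[OF bounded_linear_scaleR_right x]])
      (use xv in auto)
  from primitive_on_norm_unique[OF v this]
  have "integral {0..T} (\<lambda>s. norm (u2 s *\<^sub>R cross3 (y s) (v s) - u1 s *\<^sub>R y s)) =
      integral {0..T} (\<lambda>s. norm (w2 s *\<^sub>R cross3 (z s) (x s) - w1 s *\<^sub>R z s))"
    using \<sigma>(1) by auto
  moreover have "integral {0..T} (\<lambda>s. norm (u2 s *\<^sub>R cross3 (y s) (v s) - u1 s *\<^sub>R y s)) =
      integral {0..T} (\<lambda>s. sqrt ((u1 s)\<^sup>2 + (u2 s)\<^sup>2))"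
    by (rule integral_cong) (use norm yv in auto)
  moreover have "integral {0..T} (\<lambda>s. norm (w2 s *\<^sub>R cross3 (z s) (x s) - w1 s *\<^sub>R z s)) =
      integral {0..T} (\<lambda>s. sqrt ((w1 s)\<^sup>2 + (w2 s)\<^sup>2))"
    by (rule integral_cong) (use norm zx in auto)
  ultimately show ?thesis by simp
qed

lemma cost_PTS_eq:
  assumes "hor_PTS_ctrl T \<Gamma> u1 u2"
  shows "cost_PTS 1 T \<Gamma> = integral {0..T} (\<lambda>s. sqrt ((u1 s)\<^sup>2 + (u2 s)\<^sup>2))"
  unfolding cost_PTS_def
proof (rule some_equality)
  show "\<exists>w1 w2. hor_PTS_ctrl T \<Gamma> w1 w2 \<and> integral {0..T} (\<lambda>s. sqrt ((u1 s)\<^sup>2 + (u2 s)\<^sup>2)) =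
       integral {0..T} (\<lambda>s. sqrt ((w1 s)\<^sup>2 + 1\<^sup>2 * (w2 s)\<^sup>2))"
    using assms by auto
qed (use cost_unique[OF assms] in auto)

text \<open>The controls of \<open>g\<close> and of its contact curve differ only in the sign of
  \<open>u2\<close>, which squaring removes; thus the length inherits its uniqueness from the
  cost.\<close>

lemma length_SU2_eq_cost:
  assumes "hor_SU2 T g" "\<And>t. t \<in> {0..T} \<Longrightarrow> \<Gamma> t = contact_elt (g t)"
  shows "length_SU2 T g = cost_PTS 1 T \<Gamma>"
  unfolding length_SU2_def
proof (rule some_equality)
  have cost: "cost_PTS 1 T \<Gamma> = integral {0..T} (\<lambda>s. sqrt ((u1 s)\<^sup>2 + (u2 s)\<^sup>2))"
    if "hor_SU2_ctrl T g u1 u2" for u1 u2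
    using cost_PTS_eq[OF hor_PTS_ctrl_of_SU2[OF that assms(2)]] by simp
  then show "\<exists>u1 u2. hor_SU2_ctrl T g u1 u2 \<and>
       cost_PTS 1 T \<Gamma> = integral {0..T} (\<lambda>s. sqrt ((u1 s)\<^sup>2 + (u2 s)\<^sup>2))"
    using assms(1) by (auto simp: hor_SU2_def)
  show "l = cost_PTS 1 T \<Gamma>" if "\<exists>u1 u2. hor_SU2_ctrl T g u1 u2 \<and>
       l = integral {0..T} (\<lambda>s. sqrt ((u1 s)\<^sup>2 + (u2 s)\<^sup>2))" for l
    using that cost by auto
qed

lemma hor_SU2_in: "hor_SU2 T g \<Longrightarrow> t \<in> {0..T} \<Longrightarrow> g t \<in> SU2"
  by (auto simp: hor_SU2_def hor_SU2_ctrl_def)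

text \<open>All horizontal lifts of the same curve have the same contact curve, so their lengths
  agree and the choice in \<open>length_L41\<close> is harmless.\<close>

lemma hor_L41_imp_PTS:
  assumes "hor_L41 T \<gamma>"
  shows "hor_PTS T (PhiL \<circ> \<gamma>)" "cost_PTS 1 T (PhiL \<circ> \<gamma>) = length_L41 T \<gamma>"
proof -
  have lift: "(PhiL \<circ> \<gamma>) t = contact_elt (g t)"
    if "hor_SU2 T g" "\<forall>t\<in>{0..T}. \<gamma> t = PiL (g t)" "t \<in> {0..T}" for g t
    using that PhiL_PiL hor_SU2_in by simp
  obtain g where g: "hor_SU2 T g" "\<forall>t\<in>{0..T}. \<gamma> t = PiL (g t)"
    using assms by (auto simp: hor_L41_def)
  then obtain u1 u2 where "hor_SU2_ctrl T g u1 u2"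
    unfolding hor_SU2_def by blast
  from hor_PTS_ctrl_of_SU2[OF this lift[OF g]] show "hor_PTS T (PhiL \<circ> \<gamma>)"
    unfolding hor_PTS_def by blast
  have len: "length_SU2 T h = cost_PTS 1 T (PhiL \<circ> \<gamma>)"
    if "hor_SU2 T h" "\<forall>t\<in>{0..T}. \<gamma> t = PiL (h t)" for h
    using length_SU2_eq_cost[OF that(1) lift[OF that]] .
  have "length_L41 T \<gamma> = cost_PTS 1 T (PhiL \<circ> \<gamma>)"
    unfolding length_L41_def
    by (rule some_equality) (use g len in \<open>metis\<close>)+
  then show "cost_PTS 1 T (PhiL \<circ> \<gamma>) = length_L41 T \<gamma>" by simp
qed

section \<open>Lifting horizontal curves to SU(2)\<close>

text \<open>Keeps the first row and replaces the second by the one a quaternion must have. It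
  commutes with right multiplication by \<open>p1\<close> and \<open>p2\<close>, since the first row
  of a product depends only on the first row of the left factor.\<close>

definition quat_part :: "cmat \<Rightarrow> cmat" where
  "quat_part x = quat (Re (x $ 1 $ 1)) (Im (x $ 1 $ 2)) (Re (x $ 1 $ 2)) (Im (x $ 1 $ 1))"

lemma bounded_linear_quat_part: "bounded_linear quat_part"
  by (intro linear_conv_bounded_linear[THEN iffD1] linearI)
    (simp_all add: quat_part_def quat_def cmat_eq_iff complex_eq_iff)

lemma quat_part_mult: "quat_part (x ** p1) = quat_part x ** p1" "quat_part (x ** p2) = quat_part x ** p2"
  by (simp_all add: quat_part_def quat_def cmat_eq_iff complex_eq_iff matrix_mult_nth2 p1_def p2_def)

lemma quat_part_SU2: "g \<in> SU2 \<Longrightarrow> quat_part g = g"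
  by (auto simp: SU2_iff quat_part_def quat_eq_iff) (simp_all add: quat_def)

text \<open>The linear equation on all matrices commutes with \<open>quat_part\<close>, so this projection of a
  solution is a solution again; it stays in the quaternions and keeps its norm.\<close>
lemma SU2_ode_exists:
  assumes g0: "g0 \<in> SU2"
    and u: "u1 absolutely_integrable_on {0..T}" "u2 absolutely_integrable_on {0..T}"
  obtains g where "g 0 = g0" "hor_SU2_ctrl T g u1 u2"
proof -
  obtain x where x0: "x 0 = g0"
    and x: "primitive_on T x (\<lambda>s. u1 s *\<^sub>R (x s ** p1) + u2 s *\<^sub>R (x s ** p2))"
    using linear_ode_exists[OF bounded_linear_matrix_mult_right bounded_linear_matrix_mult_right u] .
  interpret Q: bounded_linear quat_part by (rule bounded_linear_quat_part)
  define g where "g t = quat_part (x t)" for t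
  have g: "primitive_on T g (\<lambda>s. u1 s *\<^sub>R (g s ** p1) + u2 s *\<^sub>R (g s ** p2))"
    using primitive_on_linear[OF bounded_linear_quat_part x]
    unfolding g_def Q.add Q.scaleR quat_part_mult .
  \<comment> \<open>The Euclidean inner product of first rows. Right multiplication by
    \<open>p1\<close> or \<open>p2\<close> is skew for it, so \<open>N (g t) (g t)\<close> is
    conserved.\<close>
  define N :: "cmat \<Rightarrow> cmat \<Rightarrow> real" where "N a b = Re (a $ 1 $ 1) * Re (b $ 1 $ 1) + Im (a $ 1 $ 1) * Im (b $ 1 $ 1)
     + Re (a $ 1 $ 2) * Re (b $ 1 $ 2) + Im (a $ 1 $ 2) * Im (b $ 1 $ 2)" for a b
  have N: "bounded_bilinear N"
    unfolding bilinear_conv_bounded_bilinear[symmetric] bilinear_def linear_iff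
    by (simp add: N_def algebra_simps)
  have "primitive_on T (\<lambda>t. N (g t) (g t)) (\<lambda>t. 0)"
    by (rule primitive_on_cong[OF primitive_on_bilinear[OF N g g]])
      (simp_all add: N_def p1_def p2_def matrix_mult_nth2 field_simps)
  note const = primitive_on_zero[OF this]
  have g_0: "g 0 = g0" using g0 by (simp add: g_def x0 quat_part_SU2)
  moreover have "N g0 g0 = 1"
    using g0 by (auto simp: SU2_iff N_def quat_def power2_eq_square algebra_simps)
  ultimately have "N (g t) (g t) = 1" if "t \<in> {0..T}" for t
    using const[OF that] by metis
  then have "g t \<in> SU2" if "t \<in> {0..T}" for t
    using that unfolding g_def quat_part_def
    by (intro quat_SU2) (simp add: N_def quat_def power2_eq_square algebra_simps)
  with g u g_0 that show thesis by (simp add: hor_SU2_ctrl_iff)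
qed

text \<open>Both frames turn by the same skew-symmetric system, so the sum of the inner products of
  corresponding vectors is conserved. It starts at 3 and each summand is at most 1, so all remain
  equal to 1 and the frames coincide; no Gronwall estimate is needed.\<close>

lemma frame_ode_unique:
  assumes y: "primitive_on T y (\<lambda>s. u1 s *\<^sub>R v s)"
    and v: "primitive_on T v (\<lambda>s. u2 s *\<^sub>R cross3 (y s) (v s) - u1 s *\<^sub>R y s)"
    and z: "primitive_on T z (\<lambda>s. u1 s *\<^sub>R x s)"
    and x: "primitive_on T x (\<lambda>s. u2 s *\<^sub>R cross3 (z s) (x s) - u1 s *\<^sub>R z s)"
    and yv: "\<And>t. t \<in> {0..T} \<Longrightarrow> norm (y t) = 1 \<and> norm (v t) = 1 \<and> y t \<bullet> v t = 0"
    and zx: "\<And>t. t \<in> {0..T} \<Longrightarrow> norm (z t) = 1 \<and> norm (x t) = 1 \<and> z t \<bullet> x t = 0"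
    and init: "y 0 = z 0" "v 0 = x 0" and t: "t \<in> {0..T}"
  shows "y t = z t \<and> v t = x t"
proof -
  have B: "bounded_bilinear cross3"
    using bilinear_cross bilinear_conv_bounded_bilinear by blast
  define w where "w t = cross3 (y t) (v t)" for t
  define c where "c t = cross3 (z t) (x t)" for t
  have w: "primitive_on T w (\<lambda>s. - u2 s *\<^sub>R v s)"
    unfolding w_def
    by (rule primitive_on_cong[OF primitive_on_bilinear[OF B y v]])
      (use yv cross3_orthonormal(2) in \<open>auto simp: cross_mult_left cross_mult_right Cross3.right_diff_distrib\<close>)
  have c: "primitive_on T c (\<lambda>s. - u2 s *\<^sub>R x s)"
    unfolding c_def
    by (rule primitive_on_cong[OF primitive_on_bilinear[OF B z x]])
      (use zx cross3_orthonormal(2) in \<open>auto simp: cross_mult_left cross_mult_right Cross3.right_diff_distrib\<close>)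
  note I = primitive_on_bilinear[OF bounded_bilinear_inner]
  have "primitive_on T (\<lambda>t. y t \<bullet> z t + v t \<bullet> x t + w t \<bullet> c t) (\<lambda>t. 0)"
    by (rule primitive_on_cong[OF primitive_on_add[OF primitive_on_add[OF I[OF y z] I[OF v x]] I[OF w c]]])
      (simp_all add: w_def[symmetric] c_def[symmetric] inner_diff_left inner_diff_right algebra_simps)
  from primitive_on_zero[OF this t]
  have "y t \<bullet> z t + v t \<bullet> x t + w t \<bullet> c t = y 0 \<bullet> y 0 + v 0 \<bullet> v 0 + w 0 \<bullet> w 0"
    using init by (simp add: w_def c_def)
  also have "\<dots> = 3"
    using yv[of 0] cross3_orthonormal(1)[of "y 0" "v 0"] t by (simp add: w_def norm_eq_1)
  finally have s: "y t \<bullet> z t + v t \<bullet> x t + w t \<bullet> c t = 3" .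
  have le: "a \<bullet> b \<le> 1" if "norm a = 1" "norm b = 1" for a b :: "real ^ 3"
    using norm_cauchy_schwarz[of a b] that by simp
  have eq: "a = b" if "norm a = 1" "norm b = 1" "a \<bullet> b = 1" for a b :: "real ^ 3"
  proof -
    have "(a - b) \<bullet> (a - b) = 0"
      using that by (simp add: inner_diff_left inner_diff_right norm_eq_1 inner_commute)
    then show ?thesis by simp
  qed
  have "norm (w t) = 1" "norm (c t) = 1"
    using yv[OF t] zx[OF t] cross3_orthonormal(1) by (auto simp: w_def c_def)
  then show ?thesis
    using s le[of "y t" "z t"] le[of "v t" "x t"] le[of "w t" "c t"] yv[OF t] zx[OF t]
    by (intro conjI eq) auto
qed

lemma hor_PTS_lift:
  assumes "hor_PTS T \<Gamma>"
  obtains g where "hor_SU2 T g" "\<And>t. t \<in> {0..T} \<Longrightarrow> contact_elt (g t) = \<Gamma> t"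
proof (cases "0 \<le> T")
  case False
  \<comment> \<open>For negative \<open>T\<close> the interval is empty and any curve is a
    lift.\<close>
  have "hor_SU2_ctrl T (\<lambda>t. mat 1) (\<lambda>t. 0) (\<lambda>t. 0)"
    using False by (simp add: hor_SU2_ctrl_def)
  then show thesis using that[of "\<lambda>t. mat 1"] False by (auto simp: hor_SU2_def)
next
  case True
  obtain u1 u2 y v where u: "u1 absolutely_integrable_on {0..T}" "u2 absolutely_integrable_on {0..T}"
    and yv: "\<And>t. t\<in>{0..T} \<Longrightarrow> \<Gamma> t = (y t, outer (v t)) \<and> norm (y t) = 1 \<and> norm (v t) = 1 \<and> y t \<bullet> v t = 0"
    and y: "primitive_on T y (\<lambda>s. u1 s *\<^sub>R v s)"
    and v: "primitive_on T v (\<lambda>s. u2 s *\<^sub>R cross3 (y s) (v s) - u1 s *\<^sub>R y s)"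
    using assms unfolding hor_PTS_def by (elim exE hor_PTS_ctrlE) blast
  obtain g0 where g0: "g0 \<in> SU2" "base g0 = y 0" "dir g0 = v 0"
    using frame_exists[of "y 0" "v 0"] yv[of 0] True by auto
  have "(\<lambda>s. - u2 s) absolutely_integrable_on {0..T}"
    using absolutely_integrable_linear[OF u(2) bounded_linear_minus[OF bounded_linear_ident]]
    by (simp add: o_def)
  then obtain g where g_0: "g 0 = g0" and g: "hor_SU2_ctrl T g u1 (\<lambda>s. - u2 s)"
    using SU2_ode_exists[OF g0(1) u(1)] by blast
  have SU: "\<And>t. t \<in> {0..T} \<Longrightarrow> g t \<in> SU2"
    and gp: "primitive_on T g (\<lambda>s. u1 s *\<^sub>R (g s ** p1) + (- u2 s) *\<^sub>R (g s ** p2))"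
    using g by (auto simp: hor_SU2_ctrl_iff)
  have "base (g t) = y t \<and> dir (g t) = v t" if t: "t \<in> {0..T}" for t
  proof (rule frame_ode_unique[OF frame_primitive(1)[OF gp SU] _ y v _ _ _ _ t])
    show "primitive_on T (\<lambda>t. dir (g t)) (\<lambda>s. u2 s *\<^sub>R cross3 (base (g s)) (dir (g s)) - u1 s *\<^sub>R base (g s))"
      using frame_primitive(2)[OF gp SU] by simp
  qed (use frame_SU2 SU yv g0 g_0 in auto)
  then have "contact_elt (g t) = \<Gamma> t" if "t \<in> {0..T}" for t
    using yv[OF that] that by (simp add: contact_elt_def)
  with g that show thesis by (auto simp: hor_SU2_def)
qed

lemma hor_PTS_imp_L41:
  assumes "hor_PTS T \<Gamma>"
  shows "hor_L41 T (\<lambda>t. the_inv_into L41 PhiL (\<Gamma> t))"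
proof -
  obtain g where g: "hor_SU2 T g" "\<And>t. t \<in> {0..T} \<Longrightarrow> contact_elt (g t) = \<Gamma> t"
    using hor_PTS_lift[OF assms] by blast
  have "the_inv_into L41 PhiL (\<Gamma> t) = PiL (g t)" if t: "t \<in> {0..T}" for t
  proof (rule the_inv_into_f_eq)
    show "inj_on PhiL L41" using bij_PhiL by (simp add: bij_betw_def)
    show "PhiL (PiL (g t)) = \<Gamma> t" "PiL (g t) \<in> L41"
      using PhiL_PiL hor_SU2_in[OF g(1) t] g(2)[OF t] by (auto simp: L41_def)
  qed
  with g(1) show ?thesis by (auto simp: hor_L41_def)
qed

theorem theorem3:
  shows "(\<forall>g a b c. coords g a b c \<longrightarrow> PhiL (PiL g) = pts_pt a b (- c))
    \<and> bij_betw PhiL L41 PTS2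
    \<and> (\<exists>U F. SU2 \<subseteq> U \<and> smooth_on U (F :: cmat \<Rightarrow> pts) \<and> (\<forall>g\<in>SU2. F g = PhiL (PiL g)))
    \<and> (\<forall>p\<in>PTS2. \<exists>V G. p \<in> V \<and> smooth_on V (G :: pts \<Rightarrow> cmat) \<and>
          (\<forall>q\<in>PTS2 \<inter> V. G q \<in> SU2 \<and> PhiL (PiL (G q)) = q))
    \<and> (\<forall>T \<gamma>. hor_L41 T \<gamma> \<longrightarrow>
          hor_PTS T (PhiL \<circ> \<gamma>) \<and> cost_PTS 1 T (PhiL \<circ> \<gamma>) = length_L41 T \<gamma>)
    \<and> (\<forall>T \<Gamma>. hor_PTS T \<Gamma> \<longrightarrow> hor_L41 T (\<lambda>t. the_inv_into L41 PhiL (\<Gamma> t)))"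
proof (intro conjI allI impI ballI)
  show "PhiL (PiL g) = pts_pt a b (- c)" if "coords g a b c" for g a b c
    using that by (simp add: PhiL_PiL coords_SU2 coords_contact_elt)
  show "\<exists>U F. SU2 \<subseteq> U \<and> smooth_on U (F :: cmat \<Rightarrow> pts) \<and> (\<forall>g\<in>SU2. F g = PhiL (PiL g))"
    using smooth_contact_elt PhiL_PiL by (intro exI[of _ UNIV] exI[of _ contact_elt]) auto
  show "\<exists>V G. p \<in> V \<and> smooth_on V (G :: pts \<Rightarrow> cmat) \<and>
          (\<forall>q\<in>PTS2 \<inter> V. G q \<in> SU2 \<and> PhiL (PiL (G q)) = q)" if "p \<in> PTS2" for p
    using local_section[OF that] PhiL_PiL by metis
qed (auto intro: bij_PhiL hor_L41_imp_PTS hor_PTS_imp_L41)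

end
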